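(* There exist universal constants $C,c>0$ such that the following holds. Let $\mathcal X^\star\in\mathbb R^{d_1\times\cdots\times d_N}$ be an (unknown target) tensor in tensor train format with ranks $\mathbf r=(r_1,\dots,r_{N-1})$, and let $\overline d=\max_i d_i$, $\overline r=\max_i r_i$. Suppose the linear map $\mathcal A:\mathbb R^{d_1\times\cdots\times d_N}\to\mathbb R^m$, $\mathcal A(\mathcal X)=(\langle\mathcal A_k,\mathcal X\rangle)_{k=1}^m$, is a Gaussian measurement operator, i.e. $\mathcal A_1,\dots,\mathcal A_m$ have i.i.d. standard Gaussian entries. Let $\mathbf s\in\mathbb R^m$ be the outlier vector in the measurements $\mathbf y=\mathcal A(\mathcal X^\star)+\mathbf s$, let $\mathcal S\subseteq\{1,\dots,m\}$ be its support, and let $p_s=|\mathcal S|/m$ be the fraction of outliers. Let $\delta_{2\overline r}\in\left(0,(1-2p_s)\sqrt{2/\pi}\right)$ be a positive constant. If the number of measurements satisfies $$m\ \ge\ C\,\frac{N\overline d\,\overline r^2\log N}{\delta_{2\overline r}^2},$$ then with probability exceeding $1-2e^{-cN\overline d\,\overline r^2\log N}$, $\mathcal A$ satisfies the following sharpness property: $$\frac1m\|\mathcal A(\mathcal X-\mathcal X^\star)-\mathbf s\|_1-\frac1m\|\mathbf s\|_1\ \ge\ \left((1-2p_s)\sqrt{2/\pi}-\delta_{2\overline r}\right)\|\mathcal X-\mathcal X^\star\|_F$$ holds for all tensors $\mathcal X\in\mathbb R^{d_1\times\cdots\times d_N}$ in tensor train format with ranks $\mathbf r$.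
   Context: A tensor $\mathcal X\in\mathbb R^{d_1\times\cdots\times d_N}$ is in tensor train (TT) format with ranks $\mathbf r=(r_1,\dots,r_{N-1})$ if there are order-3 tensors (factors) $\mathbf X_i\in\mathbb R^{r_{i-1}\times d_i\times r_i}$, $i=1,\dots,N$, with $r_0=r_N=1$, such that $\mathcal X(s_1,\dots,s_N)=\mathbf X_1(s_1)\mathbf X_2(s_2)\cdots\mathbf X_N(s_N)$ for all indices, where $\mathbf X_i(s_i)=\mathbf X_i(:,s_i,:)\in\mathbb R^{r_{i-1}\times r_i}$. $\langle\cdot,\cdot\rangle$ is the entrywise inner product of tensors, $\|\mathcal X\|_F=\sqrt{\langle\mathcal X,\mathcal X\rangle}$, and $\|\cdot\|_1$ is the $\ell_1$ norm on $\mathbb R^m$. The outlier vector $\mathbf s$ has nonzero entries of arbitrary magnitude, at locations that are not known a priori; its remaining entries are zero. *)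

theory Defs
  imports "HOL-Probability.Probability" "Jordan_Normal_Form.Matrix"
begin

text \<open>
  A tensor in \<open>\<real>\<^sup>d\<^sup>1 \<times> \<dots> \<times> \<real>\<^sup>d\<^sup>N\<close> is a real function on multi-indices \<open>j\<close>,
  where \<open>j i\<close> is the index in mode \<open>i\<close>, for \<open>i = 1, \<dots>, N\<close>. A vector in \<open>\<real>\<^sup>m\<close> is a real
  function on \<open>{1..m}\<close>. All notions below consult the values of these functions on these
  index sets only, so the values elsewhere are irrelevant.
\<close>

type_synonym tensor = "(nat \<Rightarrow> nat) \<Rightarrow> real"

definition multi_indices :: "nat \<Rightarrow> (nat \<Rightarrow> nat) \<Rightarrow> (nat \<Rightarrow> nat) set" where
  "multi_indices N d = (\<Pi>\<^sub>E i\<in>{1..N}. {1..d i})"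

definition tensor_inner :: "nat \<Rightarrow> (nat \<Rightarrow> nat) \<Rightarrow> tensor \<Rightarrow> tensor \<Rightarrow> real" where
  "tensor_inner N d X Y = (\<Sum>j\<in>multi_indices N d. X j * Y j)"

definition frob_norm :: "nat \<Rightarrow> (nat \<Rightarrow> nat) \<Rightarrow> tensor \<Rightarrow> real" where
  "frob_norm N d X = sqrt (tensor_inner N d X X)"

definition l1_norm :: "nat \<Rightarrow> (nat \<Rightarrow> real) \<Rightarrow> real" where
  "l1_norm m v = (\<Sum>k=1..m. \<bar>v k\<bar>)"

text \<open>
  An order-3 factor of size \<open>r (i - 1) \<times> d i \<times> r i\<close> is given by its slices: \<open>F i k\<close> is the
  \<open>r (i - 1) \<times> r i\<close> matrix obtained by fixing the middle index to \<open>k\<close>. The matrix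
  \<open>slice_prod F j N\<close> is the product of the slices \<open>F i (j i)\<close> for \<open>i = 1, \<dots>, N\<close> in this
  order. The initial factor is the \<open>1 \<times> 1\<close> identity because \<open>r 0 = 1\<close>.
\<close>

primrec slice_prod :: "(nat \<Rightarrow> nat \<Rightarrow> real mat) \<Rightarrow> (nat \<Rightarrow> nat) \<Rightarrow> nat \<Rightarrow> real mat" where
  "slice_prod F j 0 = 1\<^sub>m 1"
| "slice_prod F j (Suc n) = slice_prod F j n * F (Suc n) (j (Suc n))"

definition tt_ranks :: "nat \<Rightarrow> (nat \<Rightarrow> nat) \<Rightarrow> bool" where
  "tt_ranks N r \<longleftrightarrow> r 0 = 1 \<and> r N = 1 \<and> (\<forall>i\<in>{1..<N}. 1 \<le> r i)"

definition tt_format :: "nat \<Rightarrow> (nat \<Rightarrow> nat) \<Rightarrow> (nat \<Rightarrow> nat) \<Rightarrow> tensor \<Rightarrow> bool" where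
  "tt_format N d r X \<longleftrightarrow>
     (\<exists>F. (\<forall>i\<in>{1..N}. \<forall>k\<in>{1..d i}. F i k \<in> carrier_mat (r (i - 1)) (r i)) \<and>
          (\<forall>j\<in>multi_indices N d. X j = slice_prod F j N $$ (0, 0)))"

definition max_dim :: "nat \<Rightarrow> (nat \<Rightarrow> nat) \<Rightarrow> nat" where
  "max_dim N d = Max (d ` {1..N})"

text \<open>
  Including the boundary ranks \<open>r 0 = r N = 1\<close> does not change the maximum of
  \<open>r 1, \<dots>, r (N - 1)\<close>, and makes it well defined for \<open>N = 1\<close>.
\<close>

definition max_rank :: "nat \<Rightarrow> (nat \<Rightarrow> nat) \<Rightarrow> nat" where
  "max_rank N r = Max (r ` {0..N})"

definition measure_op ::
    "nat \<Rightarrow> (nat \<Rightarrow> nat) \<Rightarrow> (nat \<Rightarrow> tensor) \<Rightarrow> tensor \<Rightarrow> nat \<Rightarrow> real" where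
  "measure_op N d A X = (\<lambda>k. tensor_inner N d (A k) X)"

definition gaussian_tensor :: "nat \<Rightarrow> (nat \<Rightarrow> nat) \<Rightarrow> tensor measure" where
  "gaussian_tensor N d = (\<Pi>\<^sub>M j\<in>multi_indices N d. density lborel std_normal_density)"

text \<open>The joint law of \<open>m\<close> independent measurement tensors with i.i.d. standard normal entries.\<close>

definition gaussian_measurements :: "nat \<Rightarrow> (nat \<Rightarrow> nat) \<Rightarrow> nat \<Rightarrow> (nat \<Rightarrow> tensor) measure" where
  "gaussian_measurements N d m = (\<Pi>\<^sub>M k\<in>{1..m}. gaussian_tensor N d)"

definition outlier_support :: "nat \<Rightarrow> (nat \<Rightarrow> real) \<Rightarrow> nat set" where
  "outlier_support m s = {k\<in>{1..m}. s k \<noteq> 0}"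

definition outlier_fraction :: "nat \<Rightarrow> (nat \<Rightarrow> real) \<Rightarrow> real" where
  "outlier_fraction m s = real (card (outlier_support m s)) / real m"

end

theory Submission imports Defs begin

text \<open>
  With \<open>D = X - X\<^sup>\<star>\<close>, an outlier position contributes at least \<open>- \<bar>\<langle>A\<^sub>k, D\<rangle>\<bar>\<close> by the triangle
  inequality, and every other position contributes \<open>\<bar>\<langle>A\<^sub>k, D\<rangle>\<bar>\<close>. This signed sum has mean
  \<open>m (1 - 2 p\<^sub>s) sqrt (2 / pi) \<parallel>D\<parallel>\<close>. After scaling, \<open>D\<close> is a unit tensor of doubled ranks, and its factors can
  be chosen with left unfoldings of operator norm at most 1. Replacing the \<open>N\<close> factors one at a time
  shows that a net of the factors at operator norm resolution \<open>2\<^sup>-\<^sup>k / N\<close> gives a net of the tensors at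
  resolution \<open>2\<^sup>-\<^sup>k\<close>. Its cardinality explains the \<open>ln N\<close> in the sample size.

  The increments of the centered process are sub-Gaussian with respect to the Frobenius norm. A union
  bound at one scale would need a net at resolution \<open>\<delta>\<close> and lose a factor \<open>ln (1 / \<delta>)\<close>. Chaining
  from the zero tensor through the scales \<open>2\<^sup>-\<^sup>k\<close>, with increment thresholds proportional to
  \<open>\<delta> (k + 1) 2\<^sup>-\<^sup>k\<close>, avoids this loss.
\<close>

subsection \<open>Nets in unit balls of norms\<close>

text \<open>At level \<open>k\<close> the squared ratio of threshold to increment length is of order
  \<open>\<delta>\<^sup>2 * (k + 1)\<^sup>2\<close>, while the logarithm of the number of pairs of
  net points grows only like \<open>k + 1\<close>. One sample size therefore serves all levels, and
  the thresholds still sum to a multiple of \<delta>, because \<open>(k + 1) / 2 ^ k\<close> has sum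
  4.

  Doubled ranks appear because tensors of fixed ranks are not closed under subtraction. Differences
  of net points, in contrast, need no structure, since the increment bound holds for any pair of
  tensors.

  The nets are sized by counting lattice points, a discrete substitute for comparing volumes. This
  is the origin of the base 4 and of the dyadic resolutions.

  The vector \<open>s\<close> is fixed before the measurements are drawn. The signs are therefore
  constants, and the summands of the process are independent.\<close>

text \<open>
  \<open>b c x\<close> plays the role of \<open>\<nu> x \<le> c\<close> for a norm \<open>\<nu>\<close> on the real functions on \<open>I\<close>. The norm itself is
  never needed, only its balls.
\<close>

locale norm_balls =
  fixes I :: "'i set" and b :: "real \<Rightarrow> ('i \<Rightarrow> real) \<Rightarrow> bool" and L :: real
  assumes fin: "finite I"
    and b_add: "b c x \<Longrightarrow> b c' y \<Longrightarrow> b (c + c') (\<lambda>i. x i + y i)"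
    and b_scale: "b c x \<Longrightarrow> b (\<bar>a\<bar> * c) (\<lambda>i. a * x i)"
    and b_box: "(\<And>i. i \<in> I \<Longrightarrow> \<bar>x i\<bar> \<le> 1) \<Longrightarrow> b L x"
    and b_coord: "b c x \<Longrightarrow> i \<in> I \<Longrightarrow> \<bar>x i\<bar> \<le> c"
    and b_mono: "b c x \<Longrightarrow> c \<le> c' \<Longrightarrow> b c' x"
    and b_cong: "(\<And>i. i \<in> I \<Longrightarrow> x i = y i) \<Longrightarrow> b c x \<Longrightarrow> b c y"
    and L_nonneg: "0 \<le> L"
begin

lemma b_zero: "0 \<le> c \<Longrightarrow> b c (\<lambda>i. 0)"
  using b_mono[OF b_scale[OF b_box[of "\<lambda>i. 0"], of 0]] by simp

lemma b_diff:
  assumes "b c x" "b c' y"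
  shows "b (c + c') (\<lambda>i. x i - y i)"
  using b_add[OF assms(1) b_scale[OF assms(2), of "-1"]] by simp

text \<open>Counting these points replaces the volume of the ball of radius \<open>c\<close>.
  Extensional functions make the count finite.\<close>

definition lattice_ball :: "real \<Rightarrow> ('i \<Rightarrow> int) set" where
  "lattice_ball c = {z \<in> I \<rightarrow>\<^sub>E UNIV. b c (\<lambda>i. real_of_int (z i))}"

lemma finite_lattice_ball: "finite (lattice_ball c)"
proof (rule finite_subset)
  show "lattice_ball c \<subseteq> I \<rightarrow>\<^sub>E {- \<lceil>c\<rceil>..\<lceil>c\<rceil>}"
  proof
    fix z assume "z \<in> lattice_ball c"
    then have z: "z \<in> I \<rightarrow>\<^sub>E UNIV" "b c (\<lambda>i. real_of_int (z i))" by (auto simp: lattice_ball_def)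
    have "z i \<in> {- \<lceil>c\<rceil>..\<lceil>c\<rceil>}" if "i \<in> I" for i
      using b_coord[OF z(2) that] by (simp add: abs_le_iff le_ceiling_iff) linarith
    then show "z \<in> I \<rightarrow>\<^sub>E {- \<lceil>c\<rceil>..\<lceil>c\<rceil>}" using z(1) by (auto simp: PiE_iff)
  qed
  show "finite (I \<rightarrow>\<^sub>E {- \<lceil>c\<rceil>..\<lceil>c\<rceil>})" using fin by (intro finite_PiE) auto
qed

text \<open>
  Two lattice points of the ball of radius \<open>2 * c\<close> that agree modulo 4 differ by 4 times a lattice
  point of the ball of radius \<open>c\<close>.
\<close>

lemma card_lattice_ball_double: "card (lattice_ball (2 * c)) \<le> 4 ^ card I * card (lattice_ball c)"
proof -
  let ?\<pi> = "\<lambda>z. restrict (\<lambda>i. z i mod (4::int)) I"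
  let ?W = "I \<rightarrow>\<^sub>E {0..<4::int}"
  let ?F = "\<lambda>w. {z \<in> lattice_ball (2 * c). ?\<pi> z = w}"
  have fW: "finite ?W" using fin by (intro finite_PiE) auto
  have cW: "card ?W = 4 ^ card I" using fin by (simp add: card_PiE)
  have fibre: "card (?F w) \<le> card (lattice_ball c)" for w
  proof (cases "?F w = {}")
    case False
    then obtain z0 where z0: "z0 \<in> ?F w" by auto
    let ?g = "\<lambda>z. restrict (\<lambda>i. (z i - z0 i) div 4) I"
    have div: "4 * ((z i - z0 i) div 4) = z i - z0 i" if "z \<in> ?F w" "i \<in> I" for z i
    proof -
      have "?\<pi> z i = ?\<pi> z0 i" using that(1) z0 by simp
      then have "4 dvd z i - z0 i" using that(2) by (simp add: mod_eq_dvd_iff)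
      then show ?thesis by simp
    qed
    show ?thesis
    proof (rule card_inj_on_le)
      show "inj_on ?g (?F w)"
      proof (rule inj_onI)
        fix x y assume xy: "x \<in> ?F w" "y \<in> ?F w" "?g x = ?g y"
        have "x i = y i" if "i \<in> I" for i
        proof -
          have "?g x i = ?g y i" using xy(3) by simp
          then have "(x i - z0 i) div 4 = (y i - z0 i) div 4" using that by simp
          then show ?thesis using div[OF xy(1) that] div[OF xy(2) that] by linarith
        qed
        then show "x = y" using xy(1,2) by (auto simp: lattice_ball_def intro: PiE_ext)
      qed
      show "?g ` ?F w \<subseteq> lattice_ball c"
      proof clarify
        fix z assume z: "z \<in> lattice_ball (2 * c)" "w = ?\<pi> z"
        have zF: "z \<in> ?F w" using z by simp
        have "b (2 * c + 2 * c) (\<lambda>i. real_of_int (z i) - real_of_int (z0 i))"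
          using z(1) z0 by (intro b_diff) (auto simp: lattice_ball_def)
        from b_scale[OF this, of "1/4"]
        have "b c (\<lambda>i. 1/4 * (real_of_int (z i) - real_of_int (z0 i)))" by simp
        then have "b c (\<lambda>i. real_of_int (?g z i))"
        proof (rule b_cong[rotated])
          fix i assume "i \<in> I"
          then have "real_of_int (4 * ((z i - z0 i) div 4)) = real_of_int (z i - z0 i)"
            using div[OF zF] by simp
          then show "1/4 * (real_of_int (z i) - real_of_int (z0 i)) = real_of_int (?g z i)"
            using \<open>i \<in> I\<close> by simp
        qed
        then show "?g z \<in> lattice_ball c" by (simp add: lattice_ball_def)
      qed
      show "finite (lattice_ball c)" by (rule finite_lattice_ball)
    qed
  next
    case True
    then have "card (?F w) = 0" by (simp only: card.empty)
    then show ?thesis by linarith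
  qed
  have "lattice_ball (2 * c) = (\<Union>w\<in>?W. ?F w)"
    by auto
  then have "card (lattice_ball (2 * c)) = card (\<Union>w\<in>?W. ?F w)" by (rule arg_cong)
  also have "\<dots> \<le> (\<Sum>w\<in>?W. card (?F w))"
    using fW by (rule card_UN_le)
  also have "\<dots> \<le> card ?W * card (lattice_ball c)"
    using sum_bounded_above[of ?W "\<lambda>w. card (?F w)"] fibre by simp
  finally show ?thesis by (simp add: cW)
qed

lemma card_lattice_ball_pow:
  "card (lattice_ball (2 ^ k * c)) \<le> 4 ^ (k * card I) * card (lattice_ball c)"
proof (induction k)
  case (Suc k)
  have "card (lattice_ball (2 * (2 ^ k * c))) \<le> 4 ^ card I * card (lattice_ball (2 ^ k * c))"
    by (rule card_lattice_ball_double)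
  also have "\<dots> \<le> 4 ^ card I * (4 ^ (k * card I) * card (lattice_ball c))"
    using Suc by simp
  finally show ?case by (simp add: power_add mult.assoc)
qed simp

text \<open>A packing argument with counts in place of volumes. After scaling by a large
  \<open>n\<close> and rounding, each point of \<open>S\<close> carries a translate of the lattice
  ball of radius \<open>c\<close>. Separation makes the translates disjoint, all of them lie in one
  ball of radius \<open>2 ^ (k + 3) * c\<close>, and the doubling estimate compares the two
  counts.\<close>

lemma card_separated_le:
  assumes "finite S" and ball: "\<And>x. x \<in> S \<Longrightarrow> b 1 x"
    and sep: "\<And>x y. x \<in> S \<Longrightarrow> y \<in> S \<Longrightarrow> x \<noteq> y \<Longrightarrow> \<not> b ((1/2) ^ k) (\<lambda>i. x i - y i)"
  shows "card S \<le> 4 ^ ((k + 3) * card I)"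
proof -
  obtain n :: nat where n: "real n > 4 * 2 ^ k * L" "n > 0"
    using reals_Archimedean2[of "max 0 (4 * 2 ^ k * L)"] by auto
  \<comment> \<open>\<open>4 * c\<close> is the separation radius after scaling. A collision of two
    translates costs \<open>2 * c\<close> for the lattice points and \<open>2 * L\<close> for the
    rounding, and the choice of \<open>n\<close> gives \<open>L \<le> c\<close>.\<close>
  define c where "c = real n * (1/2) ^ k / 4"
  have cL: "L \<le> c" using n by (simp add: c_def field_simps)
  have c4: "4 * c \<le> real n" using power_le_one[of "1/2::real" k] n(2) by (simp add: c_def)
  have c0: "c > 0" using n(2) by (simp add: c_def)
  define z where "z = (\<lambda>x::'i \<Rightarrow> real. restrict (\<lambda>i. \<lfloor>real n * x i\<rfloor>) I)"
  have round: "b L (\<lambda>i. real n * x i - real_of_int (z x i))" for x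
  proof (rule b_box)
    fix i assume "i \<in> I"
    then show "\<bar>real n * x i - real_of_int (z x i)\<bar> \<le> 1"
      using floor_correct[of "real n * x i"] by (simp add: z_def) linarith
  qed
  let ?T = "\<lambda>(x, w). restrict (\<lambda>i. z x i + w i) I :: 'i \<Rightarrow> int"
  have inj: "inj_on ?T (S \<times> lattice_ball c)"
  proof (rule inj_onI, clarify)
    fix x w y w'
    assume x: "x \<in> S" "w \<in> lattice_ball c" and y: "y \<in> S" "w' \<in> lattice_ball c"
      and eq: "restrict (\<lambda>i. z x i + w i) I = restrict (\<lambda>i. z y i + w' i) I"
    have eqi: "z x i + w i = z y i + w' i" if "i \<in> I" for i
      using fun_cong[OF eq, of i] that by simp
    have "b (c + c) (\<lambda>i. real_of_int (w' i) - real_of_int (w i))"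
      using x y by (intro b_diff) (auto simp: lattice_ball_def)
    from b_add[OF this b_diff[OF round[of x] round[of y]]]
    have "b (c + c + (L + L)) (\<lambda>i. real n * (x i - y i))"
    proof (rule b_cong[rotated])
      fix i assume "i \<in> I"
      then have "real_of_int (z x i + w i) = real_of_int (z y i + w' i)" by (simp only: eqi)
      then show "real_of_int (w' i) - real_of_int (w i) +
         (real n * x i - real_of_int (z x i) - (real n * y i - real_of_int (z y i))) = real n * (x i - y i)"
        by (simp add: algebra_simps)
    qed
    from b_scale[OF this, of "1 / real n"]
    have "b (1 / real n * (c + c + (L + L))) (\<lambda>i. x i - y i)" using n(2) by simp
    moreover have "1 / real n * (c + c + (L + L)) \<le> 1 / real n * (4 * c)"
      using cL by (intro mult_left_mono) auto
    moreover have "1 / real n * (4 * c) = (1/2) ^ k" using n(2) by (simp add: c_def)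
    ultimately have "b ((1/2) ^ k) (\<lambda>i. x i - y i)" by (intro b_mono[where c' = "(1/2) ^ k"]) (assumption, linarith)
    then have xy: "x = y" using sep x y by blast
    have "w i = w' i" if "i \<in> I" for i using eqi[OF that] xy by simp
    then have "w = w'"
      using x y by (intro PiE_ext[of w I "\<lambda>_. UNIV"]) (auto simp: lattice_ball_def)
    with xy show "x = y \<and> w = w'" by simp
  qed
  have sub: "?T ` (S \<times> lattice_ball c) \<subseteq> lattice_ball (2 ^ (k + 3) * c)"
  proof clarify
    fix x w assume x: "x \<in> S" "w \<in> lattice_ball c"
    have "b (\<bar>real n\<bar> * 1) (\<lambda>i. real n * x i)" by (rule b_scale[OF ball[OF x(1)]])
    from b_diff[OF this round[of x]]
    have "b (real n + L) (\<lambda>i. real_of_int (z x i))" by simp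
    moreover have "b c (\<lambda>i. real_of_int (w i))" using x by (simp add: lattice_ball_def)
    ultimately have "b (real n + L + c) (\<lambda>i. real_of_int (z x i) + real_of_int (w i))"
      by (rule b_add)
    then have "b (real n + L + c) (\<lambda>i. real_of_int (restrict (\<lambda>i. z x i + w i) I i))"
      by (rule b_cong[rotated]) simp
    moreover have "real n + L + c \<le> 2 ^ (k + 3) * c"
    proof -
      have "2 ^ (k + 3) * c = 2 * real n" by (simp add: c_def power_add field_simps)
      then show ?thesis using cL c4 c0 by linarith
    qed
    ultimately have "b (2 ^ (k + 3) * c) (\<lambda>i. real_of_int (restrict (\<lambda>i. z x i + w i) I i))"
      by (rule b_mono)
    then show "restrict (\<lambda>i. z x i + w i) I \<in> lattice_ball (2 ^ (k + 3) * c)"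
      by (simp add: lattice_ball_def)
  qed
  have "card S * card (lattice_ball c) = card (S \<times> lattice_ball c)"
    by (simp add: card_cartesian_product)
  also have "\<dots> \<le> card (lattice_ball (2 ^ (k + 3) * c))"
    by (rule card_inj_on_le[OF inj sub finite_lattice_ball])
  also have "\<dots> \<le> 4 ^ ((k + 3) * card I) * card (lattice_ball c)"
    by (rule card_lattice_ball_pow)
  finally have *: "card S * card (lattice_ball c) \<le> 4 ^ ((k + 3) * card I) * card (lattice_ball c)" .
  have "b c (\<lambda>i. real_of_int (restrict (\<lambda>_. 0) I i))"
    by (rule b_cong[OF _ b_zero]) (use c0 in auto)
  then have "restrict (\<lambda>_. 0) I \<in> lattice_ball c" by (simp add: lattice_ball_def)
  then have "card (lattice_ball c) > 0" using finite_lattice_ball by (auto simp: card_gt_0_iff)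
  with * show ?thesis by simp
qed

text \<open>A separated set of largest cardinality is a net, since a point far from all its members
  could be added. The packing bound guarantees that a largest one exists.\<close>

lemma ex_net:
  obtains T where "finite T" "card T \<le> 4 ^ ((k + 3) * card I)" "\<And>t. t \<in> T \<Longrightarrow> b 1 t"
    "\<And>x. b 1 x \<Longrightarrow> \<exists>t\<in>T. b ((1/2) ^ k) (\<lambda>i. x i - t i)"
proof -
  define sp where "sp = (\<lambda>S. finite S \<and> (\<forall>x\<in>S. b 1 x) \<and>
    (\<forall>x\<in>S. \<forall>y\<in>S. x \<noteq> y \<longrightarrow> \<not> b ((1/2) ^ k) (\<lambda>i. x i - y i)))"
  have bound: "card S \<le> 4 ^ ((k + 3) * card I)" if "sp S" for S
    by (rule card_separated_le) (use that in \<open>simp_all add: sp_def\<close>)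
  have "sp {}" by (simp add: sp_def)
  moreover have "\<forall>S. sp S \<longrightarrow> card S < Suc (4 ^ ((k + 3) * card I))"
    using bound by (simp add: less_Suc_eq_le)
  ultimately have "\<exists>T. sp T \<and> (\<forall>S. sp S \<longrightarrow> card S \<le> card T)"
    by (rule ex_has_greatest_nat)
  then obtain T where T: "sp T" "\<And>S. sp S \<Longrightarrow> card S \<le> card T" by blast
  have net: "\<exists>t\<in>T. b ((1/2) ^ k) (\<lambda>i. x i - t i)" if x: "b 1 x" for x
  proof (rule ccontr)
    assume far: "\<not> ?thesis"
    have "x \<notin> T"
    proof
      assume "x \<in> T"
      moreover have "b ((1/2) ^ k) (\<lambda>i. x i - x i)" using b_zero[of "(1/2) ^ k"] by simp
      ultimately show False using far by blast
    qed
    have "\<not> b ((1/2) ^ k) (\<lambda>i. t i - x i)" if "t \<in> T" for t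
    proof
      assume "b ((1/2) ^ k) (\<lambda>i. t i - x i)"
      from b_scale[OF this, of "-1"] have "b ((1/2) ^ k) (\<lambda>i. x i - t i)" by simp
      with far that show False by blast
    qed
    with far have "\<forall>t\<in>T. \<not> b ((1/2) ^ k) (\<lambda>i. x i - t i) \<and> \<not> b ((1/2) ^ k) (\<lambda>i. t i - x i)"
      by blast
    then have "sp (insert x T)" using T(1) x unfolding sp_def by simp
    from T(2)[OF this] \<open>x \<notin> T\<close> T(1) show False by (simp add: sp_def)
  qed
  show ?thesis
  proof (rule that[of T])
    show "finite T" using T(1) by (simp add: sp_def)
    show "card T \<le> 4 ^ ((k + 3) * card I)" using T(1) by (rule bound)
    show "b 1 t" if "t \<in> T" for t using T(1) that by (simp add: sp_def)
  qed (rule net)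
qed

end

subsection \<open>Euclidean norms and QR decomposition\<close>

lemma L2_set_Times:
  "L2_set (\<lambda>(j, s). f j s) (J \<times> S) = L2_set (\<lambda>s. L2_set (\<lambda>j. f j s) J) S"
proof -
  have "(\<Sum>p\<in>J \<times> S. (case p of (j, s) \<Rightarrow> f j s)\<^sup>2) = (\<Sum>j\<in>J. \<Sum>s\<in>S. (f j s)\<^sup>2)"
    by (simp add: sum.cartesian_product case_prod_beta)
  also have "\<dots> = (\<Sum>s\<in>S. \<Sum>j\<in>J. (f j s)\<^sup>2)" by (rule sum.swap)
  finally show ?thesis by (simp add: L2_set_def sum_nonneg)
qed

lemma L2_set_abs_scale: "L2_set (\<lambda>i. c * f i) A = \<bar>c\<bar> * L2_set f A"
  by (simp add: L2_set_def power_mult_distrib sum_distrib_left[symmetric] real_sqrt_mult)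

lemma L2_set_unit: "finite A \<Longrightarrow> c \<in> A \<Longrightarrow> L2_set (\<lambda>i. if i = c then x else 0) A = \<bar>x\<bar>"
  by (simp add: L2_set_def if_distrib[of "\<lambda>y. y\<^sup>2"] cong: if_cong)

lemma abs_le_L2_set: "finite A \<Longrightarrow> i \<in> A \<Longrightarrow> \<bar>f i\<bar> \<le> L2_set f A"
  using member_le_L2_set[of A i "\<lambda>i. \<bar>f i\<bar>"] by (simp add: L2_set_def)

text \<open>
  Columns of \<open>q\<close> may be zero because the rank of \<open>M\<close> may be less than \<open>R\<close>.
\<close>

lemma gram_schmidt:
  fixes M :: "'k \<Rightarrow> nat \<Rightarrow> real"
  assumes "finite K"
  shows "\<exists>q G. (\<forall>k\<in>K. \<forall>b<R. M k b = (\<Sum>a<R. q k a * G a b)) \<and>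
    (\<forall>a<R. \<forall>b<R. a \<noteq> b \<longrightarrow> (\<Sum>k\<in>K. q k a * q k b) = 0) \<and>
    (\<forall>a<R. (\<Sum>k\<in>K. (q k a)\<^sup>2) = 1 \<or> (\<Sum>k\<in>K. (q k a)\<^sup>2) = 0 \<and> (\<forall>b. G a b = (0::real)))"
proof (induction R)
  case 0
  show ?case by simp
next
  case (Suc R)
  from Suc.IH obtain q G where qG: "\<forall>k\<in>K. \<forall>b<R. M k b = (\<Sum>a<R. q k a * G a b)"
    "\<forall>a<R. \<forall>b<R. a \<noteq> b \<longrightarrow> (\<Sum>k\<in>K. q k a * q k b) = 0"
    "\<forall>a<R. (\<Sum>k\<in>K. (q k a)\<^sup>2) = 1 \<or> (\<Sum>k\<in>K. (q k a)\<^sup>2) = 0 \<and> (\<forall>b. G a b = 0)"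
    by (elim exE conjE) (rule that)
  note M = qG(1)[rule_format] and orth = qG(2)[rule_format] and unit = qG(3)[rule_format]
  define g where "g a = (\<Sum>k\<in>K. M k R * q k a)" for a
  define w where "w k = M k R - (\<Sum>a<R. q k a * g a)" for k
  define n where "n = L2_set w K"
  \<comment> \<open>If \<open>n = 0\<close>, division by zero makes the new column zero, which
    agrees with \<open>w\<close> vanishing on \<open>K\<close>.\<close>
  define q' where "q' k a = (if a = R then w k / n else q k a)" for k a
  define G' where "G' a b = (if a = R then (if b = R then n else 0) else if b = R then g a else G a b)" for a b
  have w0: "w k = 0" if "n = 0" "k \<in> K" for k
    using that assms by (simp add: n_def L2_set_eq_0_iff)
  have nn: "n * n = (\<Sum>k\<in>K. (w k)\<^sup>2)" by (simp add: n_def L2_set_def sum_nonneg)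
  \<comment> \<open>A zero column of \<open>q\<close> gets coefficient zero, so the matching row of
    the enlarged \<open>G\<close> stays zero.\<close>
  have q0: "g a = 0" if "a < R" "(\<Sum>k\<in>K. (q k a)\<^sup>2) = 0" for a
    using that assms by (simp add: g_def sum_nonneg_eq_0_iff)
  have wq: "(\<Sum>k\<in>K. w k * q k b) = 0" if "b < R" for b
  proof -
    have "(\<Sum>k\<in>K. w k * q k b) = g b - (\<Sum>k\<in>K. \<Sum>a<R. q k a * g a * q k b)"
      by (simp add: w_def left_diff_distrib sum_subtractf g_def sum_distrib_right)
    also have "(\<Sum>k\<in>K. \<Sum>a<R. q k a * g a * q k b) = (\<Sum>a<R. \<Sum>k\<in>K. q k a * g a * q k b)"
      by (rule sum.swap)
    also have "\<dots> = (\<Sum>a<R. g a * (\<Sum>k\<in>K. q k a * q k b))"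
      by (simp add: sum_distrib_left mult_ac)
    also have "\<dots> = (\<Sum>a<R. if a = b then g b * (\<Sum>k\<in>K. (q k b)\<^sup>2) else 0)"
      using orth that by (intro sum.cong) (auto simp: power2_eq_square)
    also have "\<dots> = g b * (\<Sum>k\<in>K. (q k b)\<^sup>2)" using that by simp
    also have "\<dots> = g b" using unit[OF that] q0[OF that] by auto
    finally show ?thesis by simp
  qed
  have A: "M k b = (\<Sum>a<Suc R. q' k a * G' a b)" if "k \<in> K" "b < Suc R" for k b
  proof (cases "b = R")
    case True
    have "(\<Sum>a<Suc R. q' k a * G' a b) = (\<Sum>a<R. q k a * g a) + w k / n * n"
      using True by (simp add: q'_def G'_def)
    also have "w k / n * n = w k" using w0[OF _ that(1)] by auto
    finally show ?thesis using True by (simp add: w_def)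
  next
    case False
    then show ?thesis using that M by (simp add: q'_def G'_def)
  qed
  have B: "(\<Sum>k\<in>K. q' k a * q' k b) = 0" if "a < Suc R" "b < Suc R" "a \<noteq> b" for a b
  proof -
    have eq: "(\<Sum>k\<in>K. w k / n * q k b) = (\<Sum>k\<in>K. w k * q k b) / n" for b
      by (simp add: sum_divide_distrib)
    consider "a = R" "b < R" | "b = R" "a < R" | "a < R" "b < R" using \<open>a < Suc R\<close> \<open>b < Suc R\<close> \<open>a \<noteq> b\<close> by linarith
    then show ?thesis
    proof cases
      case 1 then show ?thesis using wq eq[of b] by (simp add: q'_def)
    next
      case 2 then show ?thesis using wq eq[of a] by (simp add: q'_def mult.commute)
    next
      case 3 then show ?thesis using orth that by (simp add: q'_def)
    qed
  qed
  have C: "(\<Sum>k\<in>K. (q' k a)\<^sup>2) = 1 \<or> (\<Sum>k\<in>K. (q' k a)\<^sup>2) = 0 \<and> (\<forall>b. G' a b = 0)" if "a < Suc R" for a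
  proof (cases "a = R")
    case True
    have "(\<Sum>k\<in>K. (q' k a)\<^sup>2) = (\<Sum>k\<in>K. (w k)\<^sup>2) / (n * n)"
      using True by (simp add: q'_def power_divide power2_eq_square sum_divide_distrib)
    then show ?thesis using True nn by (auto simp: G'_def)
  next
    case False
    then show ?thesis using that unit[of a] q0[of a] by (auto simp: q'_def G'_def)
  qed
  show ?case using A B C by (intro exI[of _ q'] exI[of _ G']) blast
qed

text \<open>\<open>q\<close> is only a contraction, as some columns may vanish, yet
  \<open>M x\<close> and \<open>G x\<close> have the same norm: the rows of \<open>G\<close> that
  belong to zero columns vanish too. This equality lets the norm be carried along the train.\<close>

lemma qr_decomposition:
  fixes M :: "'k \<Rightarrow> nat \<Rightarrow> real"
  assumes "finite K"
  obtains q G where "\<And>k b. k \<in> K \<Longrightarrow> b < R \<Longrightarrow> M k b = (\<Sum>a<R. q k a * G a b)"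
    "\<And>x. L2_set (\<lambda>k. \<Sum>b<R. M k b * x b) K = L2_set (\<lambda>a. \<Sum>b<R. G a b * x b) {..<R}"
    "\<And>x. L2_set (\<lambda>k. \<Sum>a<R. q k a * x a) K \<le> L2_set x {..<R}"
proof -
  from gram_schmidt[OF assms, of R M] obtain q G where qG: "\<forall>k\<in>K. \<forall>b<R. M k b = (\<Sum>a<R. q k a * G a b)"
    "\<forall>a<R. \<forall>b<R. a \<noteq> b \<longrightarrow> (\<Sum>k\<in>K. q k a * q k b) = 0"
    "\<forall>a<R. (\<Sum>k\<in>K. (q k a)\<^sup>2) = 1 \<or> (\<Sum>k\<in>K. (q k a)\<^sup>2) = 0 \<and> (\<forall>b. G a b = 0)"
    by (elim exE conjE) (rule that)
  note M = qG(1)[rule_format] and orth = qG(2)[rule_format] and unit = qG(3)[rule_format]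
  have norm: "(\<Sum>k\<in>K. (\<Sum>a<R. q k a * y a)\<^sup>2) = (\<Sum>a<R. (\<Sum>k\<in>K. (q k a)\<^sup>2) * (y a)\<^sup>2)" for y
  proof -
    have "(\<Sum>k\<in>K. (\<Sum>a<R. q k a * y a)\<^sup>2) = (\<Sum>k\<in>K. \<Sum>a<R. \<Sum>b<R. q k a * y a * (q k b * y b))"
      by (simp add: power2_eq_square sum_product)
    also have "\<dots> = (\<Sum>a<R. \<Sum>b<R. \<Sum>k\<in>K. q k a * y a * (q k b * y b))"
      by (subst sum.swap, intro sum.cong refl, rule sum.swap)
    also have "\<dots> = (\<Sum>a<R. \<Sum>b<R. (y a * y b) * (\<Sum>k\<in>K. q k a * q k b))"
      by (simp add: sum_distrib_left mult_ac)
    also have "\<dots> = (\<Sum>a<R. \<Sum>b<R. if a = b then (\<Sum>k\<in>K. (q k a)\<^sup>2) * (y a)\<^sup>2 else 0)"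
      using orth by (intro sum.cong refl) (auto simp: power2_eq_square)
    finally show ?thesis by simp
  qed
  have 2: "L2_set (\<lambda>k. \<Sum>b<R. M k b * x b) K = L2_set (\<lambda>a. \<Sum>b<R. G a b * x b) {..<R}" for x
  proof -
    have "(\<Sum>b<R. M k b * x b) = (\<Sum>a<R. q k a * (\<Sum>b<R. G a b * x b))" if "k \<in> K" for k
    proof -
      have "(\<Sum>b<R. M k b * x b) = (\<Sum>b<R. \<Sum>a<R. q k a * (G a b * x b))"
        using M[OF that] by (simp add: sum_distrib_right mult.assoc)
      also have "\<dots> = (\<Sum>a<R. \<Sum>b<R. q k a * (G a b * x b))" by (rule sum.swap)
      finally show ?thesis by (simp add: sum_distrib_left)
    qed
    then have "(\<Sum>k\<in>K. (\<Sum>b<R. M k b * x b)\<^sup>2) = (\<Sum>k\<in>K. (\<Sum>a<R. q k a * (\<Sum>b<R. G a b * x b))\<^sup>2)"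
      by simp
    also have "\<dots> = (\<Sum>a<R. (\<Sum>b<R. G a b * x b)\<^sup>2)"
      unfolding norm using unit by (intro sum.cong refl) force
    finally show ?thesis by (simp add: L2_set_def)
  qed
  have 3: "L2_set (\<lambda>k. \<Sum>a<R. q k a * x a) K \<le> L2_set x {..<R}" for x
    unfolding L2_set_def norm
    by (intro real_sqrt_le_mono sum_mono) (use unit in force)
  show ?thesis by (rule that[OF M 2 3])
qed

subsection \<open>Normalized tensor trains\<close>

text \<open>
  All ranks are padded with zeros to a common value \<open>R\<close>, and the entry \<open>(a, b)\<close> of slice \<open>s\<close> of
  factor \<open>i\<close> is \<open>Q (i, a, s, b)\<close>.
\<close>

primrec tt_row :: "nat \<Rightarrow> (nat \<times> nat \<times> nat \<times> nat \<Rightarrow> real) \<Rightarrow> (nat \<Rightarrow> nat) \<Rightarrow> nat \<Rightarrow> nat \<Rightarrow> real" where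
  "tt_row R Q j 0 b = (if b = 0 then 1 else 0)"
| "tt_row R Q j (Suc n) b = (\<Sum>a<R. tt_row R Q j n a * Q (Suc n, a, j (Suc n), b))"

definition slice_le :: "nat \<Rightarrow> nat set \<Rightarrow> real \<Rightarrow> (nat \<Rightarrow> nat \<Rightarrow> nat \<Rightarrow> real) \<Rightarrow> bool" where
  "slice_le R S c q \<longleftrightarrow>
     (\<forall>x. L2_set (\<lambda>(a, s). \<Sum>b<R. q a s b * x b) ({..<R} \<times> S) \<le> c * L2_set x {..<R})"

text \<open>All left unfoldings, which are the \<open>(R d\<^sub>i) \<times> R\<close> matrices, have operator norm at most \<open>c\<close>.\<close>

definition factors_le ::
    "nat \<Rightarrow> (nat \<Rightarrow> nat) \<Rightarrow> nat \<Rightarrow> real \<Rightarrow> (nat \<times> nat \<times> nat \<times> nat \<Rightarrow> real) \<Rightarrow> bool" where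
  "factors_le N d R c Q \<longleftrightarrow> (\<forall>i\<in>{1..N}. slice_le R {1..d i} c (\<lambda>a s b. Q (i, a, s, b)))"

lemma tt_row_cong:
  assumes "\<And>i. i \<in> {1..n} \<Longrightarrow> j i = j' i"
    and "\<And>i a b. i \<in> {1..n} \<Longrightarrow> a < R \<Longrightarrow> b < R \<Longrightarrow> Q (i, a, j i, b) = Q' (i, a, j i, b)"
    and "b < R"
  shows "tt_row R Q j n b = tt_row R Q' j' n b"
  using assms
proof (induction n arbitrary: b)
  case (Suc n)
  have "tt_row R Q j n a = tt_row R Q' j' n a" if "a < R" for a
    using Suc.prems that by (intro Suc.IH) auto
  moreover have "Q (Suc n, a, j (Suc n), b) = Q' (Suc n, a, j' (Suc n), b)" if "a < R" for a
    using Suc.prems(1)[of "Suc n"] Suc.prems(2)[of "Suc n" a b] Suc.prems(3) that by simp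
  ultimately show ?case by simp
qed simp

lemma finite_multi_indices [simp, intro]: "finite (multi_indices N d)"
  by (auto simp: multi_indices_def intro!: finite_PiE)

lemma bij_betw_multi_indices_Suc:
  "bij_betw (\<lambda>(j, s). j(Suc n := s)) (multi_indices n d \<times> {1..d (Suc n)}) (multi_indices (Suc n) d)"
proof -
  have S: "{1..Suc n} = insert (Suc n) {1..n}" by auto
  show ?thesis
  proof (rule bij_betw_imageI)
    show "inj_on (\<lambda>(j, s). j(Suc n := s)) (multi_indices n d \<times> {1..d (Suc n)})"
    proof (rule inj_onI, clarify)
      fix j s j' s'
      assume j: "j \<in> multi_indices n d" "j' \<in> multi_indices n d" and eq: "j(Suc n := s) = j'(Suc n := s')"
      have "j i = j' i" for i
      proof (cases "i = Suc n")
        case True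
        then show ?thesis using j by (auto simp: multi_indices_def PiE_iff extensional_def)
      next
        case False
        then show ?thesis using fun_cong[OF eq, of i] by simp
      qed
      then show "j = j' \<and> s = s'" using fun_cong[OF eq, of "Suc n"] by auto
    qed
    show "(\<lambda>(j, s). j(Suc n := s)) ` (multi_indices n d \<times> {1..d (Suc n)}) = multi_indices (Suc n) d"
      unfolding multi_indices_def S PiE_insert_eq by force
  qed
qed

lemma multi_indices_SucE:
  assumes "j \<in> multi_indices (Suc n) d"
  obtains i s where "i \<in> multi_indices n d" "s \<in> {1..d (Suc n)}" "j = i(Suc n := s)"
  using assms bij_betw_imp_surj_on[OF bij_betw_multi_indices_Suc[of n d], symmetric] by auto

lemma L2_set_multi_indices_Suc:
  "L2_set f (multi_indices (Suc n) d) =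
   L2_set (\<lambda>(j, s). f (j(Suc n := s))) (multi_indices n d \<times> {1..d (Suc n)})"
  unfolding L2_set_def sum.reindex_bij_betw[OF bij_betw_multi_indices_Suc, symmetric]
  by (simp add: case_prod_beta)

lemma tt_row_Suc_apply:
  "(\<Sum>b<R. tt_row R Q (j(Suc n := s)) (Suc n) b * x b) =
   (\<Sum>a<R. tt_row R Q j n a * (\<Sum>b<R. Q (Suc n, a, s, b) * x b))"
proof -
  have *: "tt_row R Q (j(Suc n := s)) n a = tt_row R Q j n a" if "a < R" for a
    using that by (intro tt_row_cong) auto
  have "(\<Sum>b<R. tt_row R Q (j(Suc n := s)) (Suc n) b * x b) =
        (\<Sum>b<R. \<Sum>a<R. tt_row R Q j n a * (Q (Suc n, a, s, b) * x b))"
    by (simp add: * sum_distrib_right mult.assoc)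
  also have "\<dots> = (\<Sum>a<R. \<Sum>b<R. tt_row R Q j n a * (Q (Suc n, a, s, b) * x b))" by (rule sum.swap)
  finally show ?thesis by (simp add: sum_distrib_left)
qed

text \<open>Tensoring with the identity on \<open>S\<close> keeps the operator norm: the bound holds
  for each \<open>s\<close>, and the squares are summed over \<open>s\<close>.\<close>

lemma L2_set_rows_le:
  assumes W: "\<And>y. L2_set (\<lambda>j. \<Sum>a<R. W j a * y a) J \<le> K * L2_set y {..<R}"
    and "0 \<le> K"
  shows "L2_set (\<lambda>(j, s). \<Sum>a<R. W j a * Y a s) (J \<times> S) \<le> K * L2_set (\<lambda>(a, s). Y a s) ({..<R} \<times> S)"
proof -
  have "L2_set (\<lambda>s. L2_set (\<lambda>j. \<Sum>a<R. W j a * Y a s) J) S \<le> L2_set (\<lambda>s. K * L2_set (\<lambda>a. Y a s) {..<R}) S"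
    by (rule L2_set_mono[OF W]) simp
  then show ?thesis by (simp add: L2_set_Times L2_set_right_distrib[OF \<open>0 \<le> K\<close>])
qed

text \<open>The matrix with rows \<open>j\<close> and columns \<open>b\<close> is a product of left
  unfoldings, each tensored with an identity, so the bounds 1 multiply.\<close>

lemma tt_row_norm_le:
  assumes "factors_le N d R 1 Q" "n \<le> N" "0 < R"
  shows "L2_set (\<lambda>j. \<Sum>b<R. tt_row R Q j n b * x b) (multi_indices n d) \<le> L2_set x {..<R}"
  using assms(2)
proof (induction n arbitrary: x)
  case 0
  have "multi_indices 0 d = {\<lambda>_. undefined}" by (simp add: multi_indices_def)
  moreover have "(\<Sum>b<R. (if b = 0 then 1 else 0) * x b) = x 0"
    using \<open>0 < R\<close> by (simp add: if_distrib[of "\<lambda>y. y * _"] cong: if_cong)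
  ultimately show ?case using abs_le_L2_set[of "{..<R}" 0 x] \<open>0 < R\<close> by simp
next
  case (Suc n)
  have "L2_set (\<lambda>j. \<Sum>b<R. tt_row R Q j (Suc n) b * x b) (multi_indices (Suc n) d) =
        L2_set (\<lambda>(j, s). \<Sum>a<R. tt_row R Q j n a * (\<Sum>b<R. Q (Suc n, a, s, b) * x b))
          (multi_indices n d \<times> {1..d (Suc n)})"
    unfolding L2_set_multi_indices_Suc tt_row_Suc_apply ..
  also have "\<dots> \<le> 1 * L2_set (\<lambda>(a, s). \<Sum>b<R. Q (Suc n, a, s, b) * x b) ({..<R} \<times> {1..d (Suc n)})"
    using Suc by (intro L2_set_rows_le) auto
  also have "\<dots> \<le> L2_set x {..<R}"
    using assms(1) Suc.prems by (fastforce simp: factors_le_def slice_le_def)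
  finally show ?case .
qed

text \<open>Telescoping: \<open>A B - A' B' = (A - A') B + A' (B - B')\<close>. Since the other
  factors have norm at most 1, each replacement costs only \<epsilon>, and the errors add up instead
  of compounding.\<close>

lemma tt_row_diff_norm_le:
  assumes Q: "factors_le N d R 1 Q" "factors_le N d R 1 Q'"
    and diff: "factors_le N d R \<epsilon> (\<lambda>i. Q i - Q' i)" and "n \<le> N" "0 < R" "0 \<le> \<epsilon>"
  shows "L2_set (\<lambda>j. \<Sum>b<R. (tt_row R Q j n b - tt_row R Q' j n b) * x b) (multi_indices n d)
           \<le> n * \<epsilon> * L2_set x {..<R}"
  using \<open>n \<le> N\<close>
proof (induction n arbitrary: x)
  case 0
  show ?case by (simp add: L2_set_0')
next
  case (Suc n)
  let ?J = "multi_indices n d \<times> {1..d (Suc n)}"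
  let ?W = "\<lambda>j a. tt_row R Q j n a - tt_row R Q' j n a"
  let ?Y = "\<lambda>a s. \<Sum>b<R. Q (Suc n, a, s, b) * x b"
  let ?Z = "\<lambda>a s. \<Sum>b<R. (Q (Suc n, a, s, b) - Q' (Suc n, a, s, b)) * x b"
  have "L2_set (\<lambda>j. \<Sum>b<R. (tt_row R Q j (Suc n) b - tt_row R Q' j (Suc n) b) * x b) (multi_indices (Suc n) d)
    = L2_set (\<lambda>(j, s). (\<Sum>b<R. tt_row R Q (j(Suc n := s)) (Suc n) b * x b) -
        (\<Sum>b<R. tt_row R Q' (j(Suc n := s)) (Suc n) b * x b)) ?J"
    unfolding L2_set_multi_indices_Suc left_diff_distrib sum_subtractf ..
  also have "\<dots> = L2_set (\<lambda>(j, s). (\<Sum>a<R. ?W j a * ?Y a s) + (\<Sum>a<R. tt_row R Q' j n a * ?Z a s)) ?J"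
    unfolding tt_row_Suc_apply
    by (intro L2_set_cong refl) (auto simp: left_diff_distrib right_diff_distrib sum_subtractf)
  also have "\<dots> \<le> L2_set (\<lambda>(j, s). \<Sum>a<R. ?W j a * ?Y a s) ?J +
      L2_set (\<lambda>(j, s). \<Sum>a<R. tt_row R Q' j n a * ?Z a s) ?J"
    unfolding case_prod_beta by (rule L2_set_triangle_ineq)
  also have "\<dots> \<le> n * \<epsilon> * L2_set (\<lambda>(a, s). ?Y a s) ({..<R} \<times> {1..d (Suc n)}) +
      1 * L2_set (\<lambda>(a, s). ?Z a s) ({..<R} \<times> {1..d (Suc n)})"
    using Suc \<open>0 \<le> \<epsilon>\<close> tt_row_norm_le[OF Q(2) _ \<open>0 < R\<close>, of n]
    by (intro add_mono L2_set_rows_le) auto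
  also have "\<dots> \<le> n * \<epsilon> * (1 * L2_set x {..<R}) + 1 * (\<epsilon> * L2_set x {..<R})"
    using Q(1) diff Suc.prems \<open>0 \<le> \<epsilon>\<close>
    by (intro add_mono mult_left_mono) (auto simp: factors_le_def slice_le_def)
  finally show ?case by (simp add: algebra_simps)
qed

text \<open>A QR sweep from left to right: the remainder \<open>G\<close> of one decomposition is
  multiplied into the next factor before that is decomposed. The norm identity is part of the
  induction because \<open>Q\<close> is merely a contraction and would yield only one
  inequality.\<close>

lemma tt_row_orthogonalize:
  assumes "0 < R"
  shows "\<exists>Q G. factors_le n d R 1 Q \<and>
    (\<forall>j\<in>multi_indices n d. \<forall>b<R. tt_row R F j n b = (\<Sum>a<R. tt_row R Q j n a * G a b)) \<and>
    (\<forall>x. L2_set (\<lambda>j. \<Sum>b<R. tt_row R F j n b * x b) (multi_indices n d) =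
          L2_set (\<lambda>a. \<Sum>b<R. G a b * x b) {..<R})"
proof (induction n)
  case 0
  \<comment> \<open>There is no factor yet, so any \<open>Q\<close> will do. The initial row is the
    first unit vector, hence the single entry of \<open>?G\<close>.\<close>
  let ?G = "\<lambda>a b. if a = 0 \<and> b = 0 then 1 else (0::real)"
  have *: "(\<Sum>b<R. ?G a b * x b) = (if a = 0 then x 0 else 0)" for a and x :: "nat \<Rightarrow> real"
    using assms by (simp add: if_distrib[of "\<lambda>y. y * _"] cong: if_cong)
  have "multi_indices 0 d = {\<lambda>_. undefined}" by (simp add: multi_indices_def)
  moreover have "(\<Sum>b<R. (if b = 0 then 1 else 0) * x b) = x 0" for x :: "nat \<Rightarrow> real"
    using assms by (simp add: if_distrib[of "\<lambda>y. y * _"] cong: if_cong)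
  moreover have "(if b = 0 then 1 else 0) = (\<Sum>a<R. (if a = 0 then 1 else 0) * ?G a b)" for b
    using assms by (simp add: if_distrib[of "\<lambda>y. y * _"] cong: if_cong)
  ultimately show ?case using assms
    by (intro exI[of _ F] exI[of _ ?G]) (simp add: factors_le_def * L2_set_unit)
next
  case (Suc n)
  from Suc.IH obtain Q G where QG: "factors_le n d R 1 Q"
    "\<forall>j\<in>multi_indices n d. \<forall>b<R. tt_row R F j n b = (\<Sum>a<R. tt_row R Q j n a * G a b)"
    "\<forall>x. L2_set (\<lambda>j. \<Sum>b<R. tt_row R F j n b * x b) (multi_indices n d) =
          L2_set (\<lambda>a. \<Sum>b<R. G a b * x b) {..<R}"
    by (elim exE conjE) (rule that)
  note Q = QG(1) and row = QG(2)[rule_format] and norm = QG(3)[rule_format]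
  let ?K = "{..<R} \<times> {1..d (Suc n)}"
  define M where "M = (\<lambda>(a, s) b. \<Sum>c<R. G a c * F (Suc n, c, s, b))"
  obtain q H where M: "\<And>k b. k \<in> ?K \<Longrightarrow> b < R \<Longrightarrow> M k b = (\<Sum>a<R. q k a * H a b)"
    and MH: "\<And>x. L2_set (\<lambda>k. \<Sum>b<R. M k b * x b) ?K = L2_set (\<lambda>a. \<Sum>b<R. H a b * x b) {..<R}"
    and q: "\<And>x. L2_set (\<lambda>k. \<Sum>a<R. q k a * x a) ?K \<le> L2_set x {..<R}"
    by (rule qr_decomposition[where K = ?K and R = R and M = M]) (simp, blast)
  define Q' where "Q' = (\<lambda>(i, a, s, b). if i = Suc n then q (a, s) b else Q (i, a, s, b))"
  have "factors_le (Suc n) d R 1 Q'"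
    unfolding factors_le_def
  proof
    fix i assume i: "i \<in> {1..Suc n}"
    show "slice_le R {1..d i} 1 (\<lambda>a s b. Q' (i, a, s, b))"
    proof (cases "i = Suc n")
      case True
      have "(\<lambda>(a, s). \<Sum>b<R. q (a, s) b * x b) = (\<lambda>k. \<Sum>b<R. q k b * x b)" for x
        by (simp add: fun_eq_iff)
      then show ?thesis using q True by (simp add: slice_le_def Q'_def)
    next
      case False
      then have "i \<in> {1..n}" using i by auto
      then show ?thesis using Q False by (simp add: factors_le_def Q'_def)
    qed
  qed
  moreover have "tt_row R F j (Suc n) b = (\<Sum>a<R. tt_row R Q' j (Suc n) a * H a b)"
    if j: "j \<in> multi_indices (Suc n) d" and b: "b < R" for j b
  proof -
    obtain i s where js: "i \<in> multi_indices n d" "s \<in> {1..d (Suc n)}" "j = i(Suc n := s)"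
      using j by (rule multi_indices_SucE)
    have Q'Q: "tt_row R Q' i n a = tt_row R Q i n a" if "a < R" for a
      using that by (intro tt_row_cong) (auto simp: Q'_def)
    have Fj: "tt_row R F j n a = tt_row R F i n a" if "a < R" for a
      using that js by (intro tt_row_cong) auto
    have "tt_row R F j (Suc n) b = (\<Sum>c<R. (\<Sum>a<R. tt_row R Q i n a * G a c) * F (Suc n, c, s, b))"
      using Fj row[OF js(1)] by (simp add: js(3))
    also have "\<dots> = (\<Sum>c<R. \<Sum>a<R. tt_row R Q i n a * (G a c * F (Suc n, c, s, b)))"
      by (simp add: sum_distrib_right mult.assoc)
    also have "\<dots> = (\<Sum>a<R. \<Sum>c<R. tt_row R Q i n a * (G a c * F (Suc n, c, s, b)))"
      by (rule sum.swap)
    also have "\<dots> = (\<Sum>a<R. tt_row R Q i n a * M (a, s) b)"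
      by (simp add: sum_distrib_left M_def)
    also have "\<dots> = (\<Sum>a<R. tt_row R Q' i n a * (\<Sum>c<R. Q' (Suc n, a, s, c) * H c b))"
      using js(2) b Q'Q by (intro sum.cong refl) (simp add: M Q'_def)
    also have "\<dots> = (\<Sum>c<R. tt_row R Q' j (Suc n) c * H c b)"
      unfolding js(3) tt_row_Suc_apply ..
    finally show ?thesis .
  qed
  moreover have "L2_set (\<lambda>j. \<Sum>b<R. tt_row R F j (Suc n) b * x b) (multi_indices (Suc n) d) =
          L2_set (\<lambda>a. \<Sum>b<R. H a b * x b) {..<R}" for x
  proof -
    let ?Y = "\<lambda>a s. \<Sum>b<R. F (Suc n, a, s, b) * x b"
    have Mx: "(\<Sum>c<R. G a c * ?Y c s) = (\<Sum>b<R. M (a, s) b * x b)" for a s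
    proof -
      have "(\<Sum>c<R. G a c * ?Y c s) = (\<Sum>c<R. \<Sum>b<R. G a c * F (Suc n, c, s, b) * x b)"
        by (simp add: sum_distrib_left mult.assoc)
      also have "\<dots> = (\<Sum>b<R. \<Sum>c<R. G a c * F (Suc n, c, s, b) * x b)" by (rule sum.swap)
      finally show ?thesis by (simp add: M_def sum_distrib_right)
    qed
    have "L2_set (\<lambda>j. \<Sum>b<R. tt_row R F j (Suc n) b * x b) (multi_indices (Suc n) d) =
      L2_set (\<lambda>(j, s). \<Sum>a<R. tt_row R F j n a * ?Y a s) (multi_indices n d \<times> {1..d (Suc n)})"
      unfolding L2_set_multi_indices_Suc tt_row_Suc_apply ..
    \<comment> \<open>The norm identity is applied for each fixed \<open>s\<close>, to the vector
      \<open>\<lambda>a. ?Y a s\<close>.\<close>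
    also have "\<dots> = L2_set (\<lambda>(a, s). \<Sum>c<R. G a c * ?Y c s) ?K"
      unfolding L2_set_Times norm ..
    also have "\<dots> = L2_set (\<lambda>k. \<Sum>b<R. M k b * x b) ?K"
      unfolding Mx by (intro L2_set_cong refl) auto
    finally show ?thesis using MH by simp
  qed
  ultimately show ?case by blast
qed

text \<open>Only column 0 of the last factor is read, so the sweep stops one factor early and
  \<open>G\<close> is absorbed into that column. Its Euclidean norm is \<sigma>, and division by
  \<sigma> leaves a column of norm 1.\<close>

lemma tt_row_normalize:
  assumes "0 < R" "1 \<le> N" and \<sigma>: "\<sigma> = L2_set (\<lambda>j. tt_row R F j N 0) (multi_indices N d)" "0 < \<sigma>"
  obtains Q where "factors_le N d R 1 Q"
    "\<And>j. j \<in> multi_indices N d \<Longrightarrow> tt_row R F j N 0 = \<sigma> * tt_row R Q j N 0"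
proof -
  obtain n where n: "N = Suc n" using \<open>1 \<le> N\<close> by (cases N) auto
  from tt_row_orthogonalize[OF assms(1), of n d F] obtain Q G where QG: "factors_le n d R 1 Q"
    "\<forall>j\<in>multi_indices n d. \<forall>b<R. tt_row R F j n b = (\<Sum>a<R. tt_row R Q j n a * G a b)"
    "\<forall>x. L2_set (\<lambda>j. \<Sum>b<R. tt_row R F j n b * x b) (multi_indices n d) =
          L2_set (\<lambda>a. \<Sum>b<R. G a b * x b) {..<R}"
    by (elim exE conjE) (rule that)
  note Q = QG(1) and row = QG(2)[rule_format] and norm = QG(3)[rule_format]
  define g where "g a s = (\<Sum>c<R. G a c * F (N, c, s, 0))" for a s
  \<comment> \<open>With all other columns zero, the operator norm of the last unfolding is the norm
    of its column 0.\<close>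
  define Q' where "Q' = (\<lambda>(i, a, s, b). if i = N then (if b = 0 then g a s / \<sigma> else 0) else Q (i, a, s, b))"
  have e0: "(\<Sum>b<R. f b * (if b = 0 then 1 else 0)) = f 0" for f :: "nat \<Rightarrow> real"
    using assms(1) by (simp add: if_distrib[of "\<lambda>y. _ * y"] cong: if_cong)
  have "\<sigma> = L2_set (\<lambda>(j, s). \<Sum>a<R. tt_row R F j n a * F (N, a, s, 0)) (multi_indices n d \<times> {1..d N})"
    using tt_row_Suc_apply[of R F _ n _ "\<lambda>b. if b = 0 then 1 else 0"]
    unfolding \<sigma>(1) n L2_set_multi_indices_Suc e0 by (simp only: )
  also have "\<dots> = L2_set (\<lambda>(a, s). g a s) ({..<R} \<times> {1..d N})"
    unfolding L2_set_Times norm g_def ..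
  finally have \<sigma>g: "\<sigma> = L2_set (\<lambda>(a, s). g a s) ({..<R} \<times> {1..d N})" .
  have "factors_le N d R 1 Q'"
    unfolding factors_le_def
  proof
    fix i assume i: "i \<in> {1..N}"
    show "slice_le R {1..d i} 1 (\<lambda>a s b. Q' (i, a, s, b))"
    proof (cases "i = N")
      case True
      have "L2_set (\<lambda>(a, s). \<Sum>b<R. Q' (i, a, s, b) * x b) ({..<R} \<times> {1..d i}) \<le> 1 * L2_set x {..<R}" for x
      proof -
        have "(\<Sum>b<R. Q' (i, a, s, b) * x b) = (x 0 / \<sigma>) * g a s" for a s
          using True assms(1) by (simp add: Q'_def if_distrib[of "\<lambda>y. y * _"] cong: if_cong)
        then have "L2_set (\<lambda>(a, s). \<Sum>b<R. Q' (i, a, s, b) * x b) ({..<R} \<times> {1..d i}) =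
          L2_set (\<lambda>p. (x 0 / \<sigma>) * (case p of (a, s) \<Rightarrow> g a s)) ({..<R} \<times> {1..d i})"
          by (intro L2_set_cong refl) auto
        also have "\<dots> = \<bar>x 0 / \<sigma>\<bar> * \<sigma>" unfolding L2_set_abs_scale \<sigma>g[symmetric] True by simp
        also have "\<dots> = \<bar>x 0\<bar>" using \<open>0 < \<sigma>\<close> by simp
        finally show ?thesis using abs_le_L2_set[of "{..<R}" 0 x] assms(1) by simp
      qed
      then show ?thesis by (simp add: slice_le_def)
    next
      case False
      then have "i \<in> {1..n}" using i n by auto
      then show ?thesis using Q False by (simp add: factors_le_def Q'_def)
    qed
  qed
  moreover have "tt_row R F j N 0 = \<sigma> * tt_row R Q' j N 0" if j: "j \<in> multi_indices N d" for j
  proof -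
    obtain i s where js: "i \<in> multi_indices n d" "s \<in> {1..d N}" "j = i(N := s)"
      using j unfolding n by (rule multi_indices_SucE)
    have Q'Q: "tt_row R Q' j n a = tt_row R Q i n a" if "a < R" for a
      using that js n by (intro tt_row_cong) (auto simp: Q'_def)
    have Fj: "tt_row R F j n a = tt_row R F i n a" if "a < R" for a
      using that js n by (intro tt_row_cong) auto
    have "tt_row R F j N 0 = (\<Sum>c<R. (\<Sum>a<R. tt_row R Q i n a * G a c) * F (N, c, s, 0))"
      using Fj row[OF js(1)] n by (simp add: js(3))
    also have "\<dots> = (\<Sum>c<R. \<Sum>a<R. tt_row R Q i n a * (G a c * F (N, c, s, 0)))"
      by (simp add: sum_distrib_right mult.assoc)
    also have "\<dots> = (\<Sum>a<R. \<Sum>c<R. tt_row R Q i n a * (G a c * F (N, c, s, 0)))"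
      by (rule sum.swap)
    also have "\<dots> = (\<Sum>a<R. tt_row R Q i n a * g a s)"
      by (simp add: sum_distrib_left g_def)
    also have "\<dots> = \<sigma> * (\<Sum>a<R. tt_row R Q i n a * (g a s / \<sigma>))"
      using \<open>0 < \<sigma>\<close> by (simp add: sum_divide_distrib[symmetric])
    also have "\<dots> = \<sigma> * tt_row R Q' j N 0"
      using Q'Q n js(3) by (simp add: Q'_def)
    finally show ?thesis .
  qed
  ultimately show ?thesis by (rule that)
qed

section \<open>Padding of ranks and differences of trains\<close>

text \<open>Padding is harmless because the rows vanish beyond the true rank. The induction carries
  this along, so each sum over \<rho> reduces to the sum in the matrix product.\<close>

lemma tt_format_row:
  assumes "tt_format N d r X" "tt_ranks N r" and \<rho>: "\<And>i. i \<le> N \<Longrightarrow> r i \<le> \<rho>"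
  obtains F where "\<And>j. j \<in> multi_indices N d \<Longrightarrow> X j = tt_row \<rho> F j N 0"
proof -
  from assms(1) obtain F where F: "\<And>i k. i \<in> {1..N} \<Longrightarrow> k \<in> {1..d i} \<Longrightarrow> F i k \<in> carrier_mat (r (i - 1)) (r i)"
    and X: "\<And>j. j \<in> multi_indices N d \<Longrightarrow> X j = slice_prod F j N $$ (0, 0)"
    unfolding tt_format_def by blast
  define P where "P = (\<lambda>(i, a, s, b). if a < r (i - 1) \<and> b < r i then F i s $$ (a, b) else 0)"
  have r0: "r 0 = 1" "r N = 1" using assms(2) by (simp_all add: tt_ranks_def)
  have *: "slice_prod F j n \<in> carrier_mat 1 (r n) \<and>
    (\<forall>b<\<rho>. tt_row \<rho> P j n b = (if b < r n then slice_prod F j n $$ (0, b) else 0))"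
    if j: "j \<in> multi_indices N d" and "n \<le> N" for j n
    using that(2)
  proof (induction n)
    case 0
    show ?case by (auto simp: r0)
  next
    case (Suc n)
    then have IH: "slice_prod F j n \<in> carrier_mat 1 (r n)"
      "\<And>a. a < \<rho> \<Longrightarrow> tt_row \<rho> P j n a = (if a < r n then slice_prod F j n $$ (0, a) else 0)" by auto
    have "j (Suc n) \<in> {1..d (Suc n)}"
      using j Suc.prems by (auto simp: multi_indices_def PiE_iff)
    then have C: "F (Suc n) (j (Suc n)) \<in> carrier_mat (r n) (r (Suc n))"
      using F[of "Suc n"] Suc.prems by simp
    have "tt_row \<rho> P j (Suc n) b = (if b < r (Suc n) then slice_prod F j (Suc n) $$ (0, b) else 0)" for b
    proof (cases "b < r (Suc n)")
      case True
      have "tt_row \<rho> P j (Suc n) b =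
          (\<Sum>a<\<rho>. if a < r n then slice_prod F j n $$ (0, a) * F (Suc n) (j (Suc n)) $$ (a, b) else 0)"
        using IH(2) True by (auto simp: P_def intro!: sum.cong)
      also have "\<dots> = (\<Sum>a<r n. slice_prod F j n $$ (0, a) * F (Suc n) (j (Suc n)) $$ (a, b))"
        using \<rho>[of n] Suc.prems by (intro sum.mono_neutral_cong_right) auto
      also have "\<dots> = slice_prod F j (Suc n) $$ (0, b)"
        using IH(1) C True by (simp add: scalar_prod_def lessThan_atLeast0)
      finally show ?thesis using True by simp
    next
      case False
      then show ?thesis by (simp add: P_def)
    qed
    then show ?case using IH(1) C by simp
  qed
  have "0 < \<rho>" using \<rho>[of 0] r0 by simp
  then have "X j = tt_row \<rho> P j N 0" if "j \<in> multi_indices N d" for j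
    using *[OF that, of N] X[OF that] r0 by simp
  then show ?thesis by (rule that)
qed

lemma sum_lessThan_double: "(\<Sum>a<2 * \<rho>. f a) = (\<Sum>a<\<rho>. f a) + (\<Sum>a<\<rho>. f (\<rho> + a))"
  for f :: "nat \<Rightarrow> real"
  using sum.shift_bounds_nat_ivl[of f 0 \<rho> \<rho>] sum.atLeastLessThan_concat[of 0 \<rho> "\<rho> + \<rho>" f]
  by (simp add: lessThan_atLeast0 mult_2 add.commute)

text \<open>
  The middle factors of the difference are block diagonal. The first factor is a block row and
  the last one a block column, where the second block carries the sign.
\<close>

lemma tt_row_diff:
  assumes "2 \<le> N" "1 \<le> \<rho>"
  obtains H where "\<And>j. tt_row \<rho> F j N 0 - tt_row \<rho> G j N 0 = tt_row (2 * \<rho>) H j N 0"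
proof -
  define H where "H = (\<lambda>(i, a, s, b).
    if i = 1 then (if b < \<rho> then F (i, a, s, b) else G (i, a, s, b - \<rho>))
    else if i = N then (if a < \<rho> then F (i, a, s, b) else - G (i, a - \<rho>, s, b))
    else if a < \<rho> \<and> b < \<rho> then F (i, a, s, b)
    else if \<rho> \<le> a \<and> \<rho> \<le> b then G (i, a - \<rho>, s, b - \<rho>) else 0)"
  \<comment> \<open>With \<open>2 \<le> N\<close> the block row and the block column are different
    factors.\<close>
  obtain M where M: "N = Suc M" "1 \<le> M" using assms(1) by (cases N) auto
  have e0: "(\<Sum>a<R. (if a = 0 then 1 else 0) * f a) = f 0" if "0 < R" for R and f :: "nat \<Rightarrow> real"
    using that by (simp add: if_distrib[of "\<lambda>y. y * _"] cong: if_cong)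
  have *: "tt_row (2 * \<rho>) H j n b = (if b < \<rho> then tt_row \<rho> F j n b else tt_row \<rho> G j n (b - \<rho>))"
    if "1 \<le> n" "n < N" for n b j
    using that
  proof (induction n arbitrary: b rule: dec_induct)
    case base
    show ?case using assms M by (simp add: e0 H_def)
  next
    case (step n)
    have "Suc n \<noteq> 1" "Suc n \<noteq> N" using step by auto
    then have H: "H (Suc n, a, s, b) = (if a < \<rho> \<and> b < \<rho> then F (Suc n, a, s, b)
        else if \<rho> \<le> a \<and> \<rho> \<le> b then G (Suc n, a - \<rho>, s, b - \<rho>) else 0)" for a s b
      by (simp add: H_def)
    have "tt_row (2 * \<rho>) H j (Suc n) b =
      (\<Sum>a<\<rho>. tt_row \<rho> F j n a * H (Suc n, a, j (Suc n), b)) +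
      (\<Sum>a<\<rho>. tt_row \<rho> G j n a * H (Suc n, \<rho> + a, j (Suc n), b))"
      using step by (simp add: sum_lessThan_double)
    then show ?case by (auto simp: H)
  qed
  have H: "H (N, a, s, b) = (if a < \<rho> then F (N, a, s, b) else - G (N, a - \<rho>, s, b))" for a s b
    using assms(1) by (simp add: H_def)
  have "tt_row \<rho> F j N 0 - tt_row \<rho> G j N 0 = tt_row (2 * \<rho>) H j N 0" for j
    using *[of M] H M by (simp add: sum_lessThan_double sum_negf)
  then show ?thesis by (rule that)
qed

section \<open>Nets of normalized tensor trains\<close>

lemma frob_norm_eq_L2_set: "frob_norm N d X = L2_set X (multi_indices N d)"
  by (simp add: frob_norm_def tensor_inner_def L2_set_def power2_eq_square)

text \<open>The largest unfolding norm is a norm on all factors together, so the net exponent is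
  governed by the total number of parameters. The constant for the unit cube may be crude, as it
  does not enter the size of the net.\<close>

lemma norm_balls_factors_le:
  assumes D: "\<And>i. i \<in> {1..N} \<Longrightarrow> d i \<le> D" and "0 < R"
  shows "norm_balls (SIGMA i:{1..N}. {..<R} \<times> {1..d i} \<times> {..<R}) (factors_le N d R) (real (R * D * R))"
proof
  let ?I = "SIGMA i:{1..N}. {..<R} \<times> {1..d i} \<times> {..<R}"
  show "finite ?I" by simp
  show "factors_le N d R (c + c') (\<lambda>i. x i + y i)" if "factors_le N d R c x" "factors_le N d R c' y" for c c' x y
    unfolding factors_le_def slice_le_def
  proof (intro ballI allI)
    fix i v assume i: "i \<in> {1..N}"
    let ?K = "{..<R} \<times> {1..d i}"
    have "L2_set (\<lambda>(a, s). \<Sum>b<R. (x (i, a, s, b) + y (i, a, s, b)) * v b) ?K =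
      L2_set (\<lambda>p. (case p of (a, s) \<Rightarrow> \<Sum>b<R. x (i, a, s, b) * v b) + (case p of (a, s) \<Rightarrow> \<Sum>b<R. y (i, a, s, b) * v b)) ?K"
      by (intro L2_set_cong refl) (auto simp: distrib_right sum.distrib)
    also have "\<dots> \<le> L2_set (\<lambda>(a, s). \<Sum>b<R. x (i, a, s, b) * v b) ?K + L2_set (\<lambda>(a, s). \<Sum>b<R. y (i, a, s, b) * v b) ?K"
      by (rule L2_set_triangle_ineq)
    also have "\<dots> \<le> c * L2_set v {..<R} + c' * L2_set v {..<R}"
      using that i unfolding factors_le_def slice_le_def by (intro add_mono) blast+
    finally show "L2_set (\<lambda>(a, s). \<Sum>b<R. (x (i, a, s, b) + y (i, a, s, b)) * v b) ?K \<le> (c + c') * L2_set v {..<R}"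
      by (simp add: distrib_right)
  qed
  show "factors_le N d R (\<bar>t\<bar> * c) (\<lambda>i. t * x i)" if "factors_le N d R c x" for c x t
    unfolding factors_le_def slice_le_def
  proof (intro ballI allI)
    fix i v assume i: "i \<in> {1..N}"
    let ?K = "{..<R} \<times> {1..d i}"
    have "L2_set (\<lambda>(a, s). \<Sum>b<R. (t * x (i, a, s, b)) * v b) ?K =
      L2_set (\<lambda>p. t * (case p of (a, s) \<Rightarrow> \<Sum>b<R. x (i, a, s, b) * v b)) ?K"
      by (intro L2_set_cong refl) (auto simp: sum_distrib_left mult.assoc)
    also have "\<dots> = \<bar>t\<bar> * L2_set (\<lambda>(a, s). \<Sum>b<R. x (i, a, s, b) * v b) ?K"
      by (rule L2_set_abs_scale)
    also have "\<dots> \<le> \<bar>t\<bar> * (c * L2_set v {..<R})"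
      using that i unfolding factors_le_def slice_le_def by (intro mult_left_mono) auto
    finally show "L2_set (\<lambda>(a, s). \<Sum>b<R. (t * x (i, a, s, b)) * v b) ?K \<le> \<bar>t\<bar> * c * L2_set v {..<R}"
      by (simp add: mult.assoc)
  qed
  show "factors_le N d R (real (R * D * R)) x" if x: "\<And>i. i \<in> ?I \<Longrightarrow> \<bar>x i\<bar> \<le> 1" for x
    unfolding factors_le_def slice_le_def
  proof (intro ballI allI)
    fix i v assume i: "i \<in> {1..N}"
    let ?K = "{..<R} \<times> {1..d i}" and ?v = "L2_set v {..<R}"
    have "\<bar>\<Sum>b<R. x (i, a, s, b) * v b\<bar> \<le> real R * ?v" if "a < R" "s \<in> {1..d i}" for a s
    proof -
      have "\<bar>\<Sum>b<R. x (i, a, s, b) * v b\<bar> \<le> (\<Sum>b<R. \<bar>x (i, a, s, b) * v b\<bar>)" by (rule sum_abs)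
      also have "\<dots> \<le> (\<Sum>b<R. 1 * ?v)"
        unfolding abs_mult using x i that by (intro sum_mono mult_mono abs_le_L2_set) auto
      finally show ?thesis by simp
    qed
    then have "(\<Sum>p\<in>?K. \<bar>case p of (a, s) \<Rightarrow> \<Sum>b<R. x (i, a, s, b) * v b\<bar>) \<le> (\<Sum>p\<in>?K. real R * ?v)"
      by (intro sum_mono) auto
    with L2_set_le_sum_abs[of "\<lambda>(a, s). \<Sum>b<R. x (i, a, s, b) * v b" ?K]
    have "L2_set (\<lambda>(a, s). \<Sum>b<R. x (i, a, s, b) * v b) ?K \<le> real (R * d i) * (real R * ?v)"
      by (simp add: card_cartesian_product)
    also have "\<dots> \<le> real (R * D) * (real R * ?v)"
      using D[OF i] by (intro mult_right_mono of_nat_mono mult_le_mono2) auto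
    finally show "L2_set (\<lambda>(a, s). \<Sum>b<R. x (i, a, s, b) * v b) ?K \<le> real (R * D * R) * ?v"
      by (simp add: mult_ac)
  qed
  show "\<bar>x k\<bar> \<le> c" if x: "factors_le N d R c x" and kI: "k \<in> ?I" for c x k
  proof -
    obtain i a s b where k: "k = (i, a, s, b)" "i \<in> {1..N}" "a < R" "s \<in> {1..d i}" "b < R"
      using kI by auto
    \<comment> \<open>Testing the operator norm on a unit vector isolates column
      \<open>b\<close>.\<close>
    have eq: "(\<Sum>b'<R. x (i, a, s, b') * (if b' = b then 1 else 0)) = x (i, a, s, b)" for a s
      using k(5) by (simp add: if_distrib[of "\<lambda>y. _ * y"] cong: if_cong)
    have "slice_le R {1..d i} c (\<lambda>a s b. x (i, a, s, b))"
      using x k(2) by (simp add: factors_le_def)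
    then have "L2_set (\<lambda>(a, s). x (i, a, s, b)) ({..<R} \<times> {1..d i}) \<le> c * L2_set (\<lambda>b'. if b' = b then 1 else 0) {..<R}"
      unfolding slice_le_def by (rule allE[of _ "\<lambda>b'. if b' = b then 1 else 0"]) (simp only: eq)
    then have "L2_set (\<lambda>(a, s). x (i, a, s, b)) ({..<R} \<times> {1..d i}) \<le> c"
      using k(5) by (simp add: L2_set_unit)
    then show ?thesis
      using abs_le_L2_set[of "{..<R} \<times> {1..d i}" "(a, s)" "\<lambda>(a, s). x (i, a, s, b)"] k by simp
  qed
  show "factors_le N d R c' x" if "factors_le N d R c x" "c \<le> c'" for c c' x
  proof -
    have "c * L2_set v {..<R} \<le> c' * L2_set v {..<R}" for v
      using that(2) by (intro mult_right_mono) auto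
    then show ?thesis using that(1) unfolding factors_le_def slice_le_def by (meson order_trans)
  qed
  show "factors_le N d R c y" if xy: "\<And>i. i \<in> ?I \<Longrightarrow> x i = y i" and x: "factors_le N d R c x" for c x y
  proof -
    have "L2_set (\<lambda>(a, s). \<Sum>b<R. x (i, a, s, b) * v b) ({..<R} \<times> {1..d i}) =
          L2_set (\<lambda>(a, s). \<Sum>b<R. y (i, a, s, b) * v b) ({..<R} \<times> {1..d i})" if "i \<in> {1..N}" for i v
    proof (rule L2_set_cong[OF refl])
      fix p assume "p \<in> {..<R} \<times> {1..d i}"
      with that show "(case p of (a, s) \<Rightarrow> \<Sum>b<R. x (i, a, s, b) * v b) = (case p of (a, s) \<Rightarrow> \<Sum>b<R. y (i, a, s, b) * v b)"
        by (auto simp: xy intro!: sum.cong)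
    qed
    then show ?thesis using x unfolding factors_le_def slice_le_def by simp
  qed
  show "0 \<le> real (R * D * R)" by simp
qed

text \<open>\<open>l\<close> is a dyadic bound for \<open>N\<close>: the resolution
  \<open>(1/2) ^ (k + l)\<close> of the factors absorbs the loss of \<open>N\<close> in the
  telescoping. Passing from the net factors to their trains cannot increase the cardinality.\<close>

lemma ex_tt_net:
  assumes D: "\<And>i. i \<in> {1..N} \<Longrightarrow> d i \<le> D" and "0 < R" "N \<le> 2 ^ l"
  obtains T where "finite T" "card T \<le> 4 ^ ((k + l + 3) * (N * D * R\<^sup>2))"
    "\<And>Q. factors_le N d R 1 Q \<Longrightarrow> \<exists>t\<in>T. frob_norm N d ((\<lambda>j. tt_row R Q j N 0) - t) \<le> (1/2) ^ k"
proof -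
  let ?I = "SIGMA i:{1..N}. {..<R} \<times> {1..d i} \<times> {..<R}"
  interpret norm_balls ?I "factors_le N d R" "real (R * D * R)"
    using norm_balls_factors_le[OF D \<open>0 < R\<close>] .
  obtain S where S: "finite S" "card S \<le> 4 ^ ((k + l + 3) * card ?I)" "\<And>t. t \<in> S \<Longrightarrow> factors_le N d R 1 t"
    "\<And>Q. factors_le N d R 1 Q \<Longrightarrow> \<exists>t\<in>S. factors_le N d R ((1/2) ^ (k + l)) (\<lambda>i. Q i - t i)"
    using ex_net[of "k + l"] by blast
  let ?\<Phi> = "\<lambda>Q j. tt_row R Q j N 0"
  have "card ?I = (\<Sum>i\<in>{1..N}. R * d i * R)" by (simp add: card_cartesian_product mult_ac)
  also have "\<dots> \<le> (\<Sum>i\<in>{1..N}. R * D * R)" using D by (intro sum_mono) simp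
  finally have cI: "card ?I \<le> N * D * R\<^sup>2" by (simp add: power2_eq_square mult_ac)
  have "card (?\<Phi> ` S) \<le> card S" using S(1) by (rule card_image_le)
  also have "\<dots> \<le> 4 ^ ((k + l + 3) * card ?I)" by (rule S(2))
  also have "\<dots> \<le> 4 ^ ((k + l + 3) * (N * D * R\<^sup>2))"
    using cI by (intro power_increasing mult_le_mono2) auto
  finally have cT: "card (?\<Phi> ` S) \<le> 4 ^ ((k + l + 3) * (N * D * R\<^sup>2))" .
  have "\<exists>t\<in>?\<Phi> ` S. frob_norm N d (?\<Phi> Q - t) \<le> (1/2) ^ k" if Q: "factors_le N d R 1 Q" for Q
  proof -
    obtain t where t: "t \<in> S" "factors_le N d R ((1/2) ^ (k + l)) (\<lambda>i. Q i - t i)" using S(4)[OF Q] by blast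
    have eq: "(\<Sum>b<R. f b * (if b = 0 then 1 else 0)) = f 0" for f :: "nat \<Rightarrow> real"
      using \<open>0 < R\<close> by (simp add: if_distrib[of "\<lambda>y. _ * y"] cong: if_cong)
    have "frob_norm N d (?\<Phi> Q - ?\<Phi> t) \<le> N * (1/2) ^ (k + l) * L2_set (\<lambda>b. if b = 0 then 1 else 0) {..<R}"
      using tt_row_diff_norm_le[OF Q S(3)[OF t(1)] t(2) order_refl \<open>0 < R\<close>, of "\<lambda>b. if b = 0 then 1 else 0"]
      unfolding eq frob_norm_eq_L2_set by (simp add: fun_diff_def)
    also have "\<dots> = (1/2) ^ k * (N / 2 ^ l)"
      using \<open>0 < R\<close> by (simp add: L2_set_unit power_add power_divide)
    also have "\<dots> \<le> (1/2) ^ k * 1"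
      using of_nat_mono[OF \<open>N \<le> 2 ^ l\<close>, where 'a = real] by (intro mult_left_mono) auto
    finally show ?thesis using t(1) by auto
  qed
  with S(1) cT show ?thesis by (intro that[of "?\<Phi> ` S"]) auto
qed

lemma tt_diff_normalize:
  assumes N: "2 \<le> N" and r: "tt_ranks N r" "\<And>i. i \<le> N \<Longrightarrow> r i \<le> \<rho>"
    and X: "tt_format N d r X" "tt_format N d r Y" and pos: "0 < frob_norm N d (X - Y)"
  obtains Q where "factors_le N d (2 * \<rho>) 1 Q"
    "\<And>j. j \<in> multi_indices N d \<Longrightarrow> (X - Y) j = frob_norm N d (X - Y) * tt_row (2 * \<rho>) Q j N 0"
proof -
  obtain F where F: "\<And>j. j \<in> multi_indices N d \<Longrightarrow> X j = tt_row \<rho> F j N 0"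
    using tt_format_row[OF X(1) r] by blast
  obtain G where G: "\<And>j. j \<in> multi_indices N d \<Longrightarrow> Y j = tt_row \<rho> G j N 0"
    using tt_format_row[OF X(2) r] by blast
  have "1 \<le> \<rho>" using r(2)[of 0] r(1) by (simp add: tt_ranks_def)
  obtain H where H: "\<And>j. tt_row \<rho> F j N 0 - tt_row \<rho> G j N 0 = tt_row (2 * \<rho>) H j N 0"
    using tt_row_diff[OF N \<open>1 \<le> \<rho>\<close>, of F G] by blast
  have XY: "(X - Y) j = tt_row (2 * \<rho>) H j N 0" if "j \<in> multi_indices N d" for j
    using F[OF that] G[OF that] H by simp
  then have "frob_norm N d (X - Y) = L2_set (\<lambda>j. tt_row (2 * \<rho>) H j N 0) (multi_indices N d)"
    unfolding frob_norm_eq_L2_set by (rule L2_set_cong[OF refl])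
  from tt_row_normalize[OF _ _ this pos] \<open>1 \<le> \<rho>\<close> N
  obtain Q where "factors_le N d (2 * \<rho>) 1 Q"
    "\<And>j. j \<in> multi_indices N d \<Longrightarrow> tt_row (2 * \<rho>) H j N 0 = frob_norm N d (X - Y) * tt_row (2 * \<rho>) Q j N 0"
    by auto
  with XY show ?thesis by (intro that[of Q]) auto
qed

subsection \<open>Sub-Gaussian estimates\<close>

abbreviation std_normal :: "real measure" where
  "std_normal \<equiv> density lborel std_normal_density"

lemma prob_space_std_normal: "prob_space std_normal"
  by (rule prob_space_normal_density) simp

lemma measurable_std_normal_coordinate:
  "j \<in> J \<Longrightarrow> (\<lambda>x. x j) \<in> borel_measurable (Pi\<^sub>M J (\<lambda>_. std_normal))"
  using measurable_component_singleton[of j J "\<lambda>_. std_normal"] by simp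

lemma indep_vars_PiM_std_normal:
  assumes "J \<noteq> {}"
  shows "prob_space.indep_vars (Pi\<^sub>M J (\<lambda>_. std_normal)) (\<lambda>_. borel) (\<lambda>j x. x j) J"
proof -
  let ?M = "Pi\<^sub>M J (\<lambda>_. std_normal)"
  interpret prob_space ?M by (intro prob_space_PiM prob_space_std_normal)
  have comp: "distr ?M borel (\<lambda>x. x j) = std_normal" if "j \<in> J" for j
  proof -
    have "distr ?M borel (\<lambda>x. x j) = distr ?M std_normal (\<lambda>x. x j)"
      by (rule distr_cong) simp_all
    also have "\<dots> = std_normal"
      using that prob_space_std_normal by (intro distr_PiM_component) auto
    finally show ?thesis .
  qed
  have "distr ?M (Pi\<^sub>M J (\<lambda>_. borel)) (\<lambda>x. \<lambda>j\<in>J. x j) = distr ?M ?M (\<lambda>x. x)"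
  proof (rule distr_cong)
    show "sets (Pi\<^sub>M J (\<lambda>_. borel)) = sets ?M" by (intro sets_PiM_cong) auto
  qed (auto simp: space_PiM)
  also have "\<dots> = Pi\<^sub>M J (\<lambda>j. distr ?M borel (\<lambda>x. x j))"
    using comp by (simp cong: PiM_cong)
  finally show ?thesis
    using assms by (subst indep_vars_iff_distr_eq_PiM') (simp_all add: measurable_std_normal_coordinate)
qed

lemma distributed_PiM_std_normal:
  assumes "j \<in> J"
  shows "distributed (Pi\<^sub>M J (\<lambda>_. std_normal)) lborel (\<lambda>x. x j) std_normal_density"
proof -
  let ?M = "Pi\<^sub>M J (\<lambda>_. std_normal)"
  have "distr ?M lborel (\<lambda>x. x j) = distr ?M std_normal (\<lambda>x. x j)"
    by (rule distr_cong) simp_all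
  also have "\<dots> = std_normal"
    using assms prob_space_std_normal by (intro distr_PiM_component) auto
  finally show ?thesis
    using assms by (simp add: distributed_def measurable_std_normal_coordinate)
qed

lemma distributed_linear_std_normal:
  assumes "finite J" and \<sigma>: "0 < L2_set v J"
  shows "distributed (Pi\<^sub>M J (\<lambda>_. std_normal)) lborel (\<lambda>x. \<Sum>j\<in>J. x j * v j) (normal_density 0 (L2_set v J))"
proof -
  \<comment> \<open>Zero coefficients are dropped, since a normal density needs a positive
    deviation. The positive norm of \<open>v\<close> keeps \<open>?K\<close> nonempty.\<close>
  let ?M = "Pi\<^sub>M J (\<lambda>_. std_normal)" and ?K = "{j\<in>J. v j \<noteq> 0}"
  interpret prob_space ?M by (intro prob_space_PiM prob_space_std_normal)
  have K: "?K \<noteq> {}" using \<sigma> L2_set_0'[of J v] by force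
  then have "J \<noteq> {}" by auto
  have "indep_vars (\<lambda>_. borel) (\<lambda>j x. x j) ?K"
    by (rule indep_vars_subset[OF indep_vars_PiM_std_normal[OF \<open>J \<noteq> {}\<close>]]) auto
  then have "indep_vars (\<lambda>_. borel) (\<lambda>j x. x j * v j) ?K"
    by (rule indep_vars_compose2) simp
  moreover have "distributed ?M lborel (\<lambda>x. x j * v j) (normal_density 0 \<bar>v j\<bar>)" if "j \<in> ?K" for j
    using normal_density_affine[OF distributed_PiM_std_normal[of j J], of "v j" 0] that
    by (simp add: mult.commute)
  ultimately have "distributed ?M lborel (\<lambda>x. \<Sum>j\<in>?K. x j * v j)
     (normal_density (\<Sum>j\<in>?K. 0) (sqrt (\<Sum>j\<in>?K. \<bar>v j\<bar>\<^sup>2)))"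
    using K assms(1) by (intro sum_indep_normal) auto
  moreover have "(\<Sum>j\<in>?K. x j * v j) = (\<Sum>j\<in>J. x j * v j)" for x
    using assms(1) by (intro sum.mono_neutral_left) auto
  moreover have "(\<Sum>j\<in>?K. \<bar>v j\<bar>\<^sup>2) = (\<Sum>j\<in>J. (v j)\<^sup>2)"
    using assms(1) by (intro sum.mono_neutral_cong_left) auto
  ultimately show ?thesis by (simp add: L2_set_def)
qed

text \<open>For a centered variable the linear term has expectation zero, so this reduces its moment
  generating function to the exponential moment of its square.\<close>

lemma exp_le_add_exp_square: "exp x \<le> x + exp (x\<^sup>2)" for x :: real
proof -
  have sq: "1 + x\<^sup>2 \<le> exp (x\<^sup>2)" by (rule exp_ge_add_one_self)
  consider "x \<le> -1" | "-1 \<le> x" "x \<le> 0" | "0 \<le> x" "x \<le> 1" | "1 \<le> x" by linarith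
  then show ?thesis
  proof cases
    case 1
    then have "0 \<le> (- x) * (- x - 1)" by (intro mult_nonneg_nonneg) auto
    then have "0 \<le> x + x\<^sup>2" by (simp add: power2_eq_square algebra_simps)
    moreover have "exp x \<le> 1" using 1 by simp
    ultimately show ?thesis using sq by linarith
  next
    case 2
    have "exp x = inverse (exp (- x))" by (simp add: exp_minus)
    also have "\<dots> \<le> inverse (1 - x)"
      using exp_ge_add_one_self[of "- x"] 2 by (intro le_imp_inverse_le) auto
    also have "\<dots> \<le> 1 + x + x\<^sup>2"
    proof -
      have "x ^ 3 \<le> 0" using 2 by (simp add: power_le_zero_eq)
      then have "1 \<le> (1 + x + x\<^sup>2) * (1 - x)" by (simp add: power2_eq_square power3_eq_cube algebra_simps)
      then show ?thesis using 2 by (simp add: field_simps)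
    qed
    finally show ?thesis using sq by linarith
  next
    case 3
    then have "exp x \<le> 1 + x + x\<^sup>2" by (rule exp_bound)
    then show ?thesis using sq by linarith
  next
    case 4
    then have "x \<le> x\<^sup>2" by (simp add: power2_eq_square)
    then show ?thesis using 4 by (smt (verit) exp_le_cancel_iff)
  qed
qed

text \<open>With \<open>y = 2 * u * \<sigma>\<^sup>2\<close> the left side is the expectation of
  \<open>exp (u * W\<^sup>2)\<close> for a centered normal \<open>W\<close> of deviation \<sigma>.
  The bound is the square root of \<open>exp (- (2 * y)) \<le> 1 - y\<close>.\<close>

lemma inverse_sqrt_le_exp:
  assumes "0 \<le> y" "y \<le> (1/2 :: real)"
  shows "1 / sqrt (1 - y) \<le> exp y"
proof -
  have "exp (- (2 * y)) = inverse (exp (2 * y))" by (simp add: exp_minus)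
  also have "\<dots> \<le> inverse (1 + 2 * y)"
    using exp_ge_add_one_self[of "2 * y"] assms by (intro le_imp_inverse_le) auto
  also have "\<dots> \<le> 1 - y"
  proof -
    have "0 \<le> y * (1 - 2 * y)" using assms by (intro mult_nonneg_nonneg) auto
    then have "1 \<le> (1 - y) * (1 + 2 * y)" by (simp add: algebra_simps)
    then show ?thesis using assms by (simp add: field_simps)
  qed
  finally have "sqrt (exp (- (2 * y))) \<le> sqrt (1 - y)" by (rule real_sqrt_le_mono)
  moreover have "sqrt (exp (- (2 * y))) = exp (- y)"
    by (rule real_sqrt_unique) (simp_all add: power2_eq_square exp_add[symmetric])
  ultimately have "1 / sqrt (1 - y) \<le> 1 / exp (- y)"
    by (intro divide_left_mono) (use assms in auto)
  then show ?thesis by (simp add: exp_minus inverse_eq_divide)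
qed

lemma nn_integral_exp_square_normal:
  assumes W: "distributed M lborel W (normal_density 0 \<sigma>)" and "0 < \<sigma>" and u: "0 \<le> u" "4 * u * \<sigma>\<^sup>2 \<le> 1"
  shows "(\<integral>\<^sup>+x. ennreal (exp (u * (W x)\<^sup>2)) \<partial>M) \<le> ennreal (exp (2 * u * \<sigma>\<^sup>2))"
proof -
  define c where "c = sqrt (1 - 2 * u * \<sigma>\<^sup>2)"
  have "2 * u * \<sigma>\<^sup>2 < 1" using u by linarith
  then have c: "0 < c" "c\<^sup>2 = 1 - 2 * u * \<sigma>\<^sup>2" by (simp_all add: c_def)
  \<comment> \<open>Multiplying by \<open>exp (u * x\<^sup>2)\<close> gives a multiple of the normal
    density with the wider deviation \<open>\<sigma> / c\<close>, and \<open>1 / c\<close> is its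
    total mass.\<close>
  have dens: "normal_density 0 \<sigma> x * exp (u * x\<^sup>2) = 1 / c * normal_density 0 (\<sigma> / c) x" for x
  proof -
    have "- (x\<^sup>2 / (2 * \<sigma>\<^sup>2)) + u * x\<^sup>2 = - (x\<^sup>2 / (2 * (\<sigma> / c)\<^sup>2))"
      using \<open>0 < \<sigma>\<close> by (simp add: power_divide c(2) field_simps)
    moreover have "sqrt (2 * pi * (\<sigma> / c)\<^sup>2) = sqrt (2 * pi * \<sigma>\<^sup>2) / c"
      using c(1) by (simp add: power_divide real_sqrt_divide)
    ultimately show ?thesis
      using c(1) by (simp add: normal_density_def exp_add[symmetric])
  qed
  have "(\<integral>\<^sup>+x. ennreal (exp (u * (W x)\<^sup>2)) \<partial>M) =
    (\<integral>\<^sup>+x. ennreal (normal_density 0 \<sigma> x) * ennreal (exp (u * x\<^sup>2)) \<partial>lborel)"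
    by (rule distributed_nn_integral[OF W, symmetric]) simp
  also have "\<dots> = (\<integral>\<^sup>+x. ennreal (1 / c) * ennreal (normal_density 0 (\<sigma> / c) x) \<partial>lborel)"
    using c(1) by (intro nn_integral_cong) (simp add: ennreal_mult[symmetric] dens)
  also have "\<dots> = ennreal (1 / c) * (\<integral>\<^sup>+x. ennreal (normal_density 0 (\<sigma> / c) x) \<partial>lborel)"
    by (rule nn_integral_cmult) simp
  also have "(\<integral>\<^sup>+x. ennreal (normal_density 0 (\<sigma> / c) x) \<partial>lborel) = 1"
    using \<open>0 < \<sigma>\<close> c(1) by (subst nn_integral_eq_integral) auto
  also have "ennreal (1 / c) * 1 \<le> ennreal (exp (2 * u * \<sigma>\<^sup>2))"
    using inverse_sqrt_le_exp[of "2 * u * \<sigma>\<^sup>2"] u by (auto simp: c_def intro!: ennreal_leI)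
  finally show ?thesis .
qed

lemma (in prob_space) expectation_abs_normal:
  assumes W: "distributed M lborel W (normal_density 0 \<sigma>)" and "0 < \<sigma>"
  shows "integrable M (\<lambda>x. \<bar>W x\<bar>)" "expectation (\<lambda>x. \<bar>W x\<bar>) = \<sigma> * sqrt (2 / pi)"
proof -
  have b: "has_bochner_integral lborel (\<lambda>x. normal_density 0 \<sigma> x * \<bar>x\<bar>) (\<sigma> * sqrt (2 / pi))"
    using normal_moment_abs_odd[of \<sigma> 0 0] by (simp add: \<open>0 < \<sigma>\<close>)
  show "integrable M (\<lambda>x. \<bar>W x\<bar>)"
    using distributed_integrable[OF W, of "\<lambda>x. \<bar>x\<bar>"] b by (auto simp: has_bochner_integral_iff)
  show "expectation (\<lambda>x. \<bar>W x\<bar>) = \<sigma> * sqrt (2 / pi)"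
    using distributed_integral[OF W, of "\<lambda>x. \<bar>x\<bar>"] b by (auto simp: has_bochner_integral_iff)
qed

text \<open>Domination by \<open>W\<close> controls the size of \<open>Z\<close> but not its mean,
  which accounts for the centering. For small \<open>l\<close> the linear term beside the
  exponential of the square integrates to zero. For large \<open>l\<close> the linear exponent is
  absorbed by a square at a cost quadratic in \<open>l\<close>. The regimes meet at
  \<open>8 * l\<^sup>2 * \<sigma>\<^sup>2 = 1\<close>.\<close>

lemma (in prob_space) mgf_le_if_dominated_by_normal:
  assumes W: "distributed M lborel W (normal_density 0 \<sigma>)" and "0 < \<sigma>"
    and Z[measurable]: "Z \<in> borel_measurable M" and ZW: "\<And>x. x \<in> space M \<Longrightarrow> \<bar>Z x\<bar> \<le> \<bar>W x\<bar>"
  shows "(\<integral>\<^sup>+x. ennreal (exp (l * (Z x - expectation Z))) \<partial>M) \<le> ennreal (exp (8 * l\<^sup>2 * \<sigma>\<^sup>2))"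
proof -
  have Wm[measurable]: "W \<in> borel_measurable M" using W by (simp add: distributed_def)
  note intW = expectation_abs_normal[OF W \<open>0 < \<sigma>\<close>]
  have intZ: "integrable M Z"
    by (rule Bochner_Integration.integrable_bound[OF intW(1)]) (use ZW in auto)
  define e where "e = expectation Z"
  define Y where "Y x = Z x - e" for x
  have [measurable]: "Y \<in> borel_measurable M" by (simp add: Y_def[abs_def])
  have intY: "integrable M Y" "expectation Y = 0"
    using intZ by (simp_all add: Y_def[abs_def] e_def prob_space)
  have "\<bar>e\<bar> \<le> expectation (\<lambda>x. \<bar>Z x\<bar>)" unfolding e_def by (rule integral_abs_bound)
  also have "\<dots> \<le> expectation (\<lambda>x. \<bar>W x\<bar>)"
    using intZ intW ZW by (intro integral_mono) auto
  also have "\<dots> \<le> \<sigma> * 1" unfolding intW(2)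
    using \<open>0 < \<sigma>\<close> pi_gt3 by (intro mult_left_mono) (auto simp: real_sqrt_le_1_iff)
  finally have e: "e\<^sup>2 \<le> \<sigma>\<^sup>2" using power_mono[of "\<bar>e\<bar>" \<sigma> 2] by simp
  \<comment> \<open>By \<open>(Z - e)\<^sup>2 \<le> 2 * Z\<^sup>2 + 2 * e\<^sup>2\<close>, the mean
    contributes 2 to the constant 6, and the square of \<open>W\<close>, with exponent
    \<open>2 * u\<close>, contributes 4.\<close>
  have Y2: "(\<integral>\<^sup>+x. ennreal (exp (u * (Y x)\<^sup>2)) \<partial>M) \<le> ennreal (exp (6 * u * \<sigma>\<^sup>2))"
    if u: "0 \<le> u" "8 * u * \<sigma>\<^sup>2 \<le> 1" for u
  proof -
    have "u * (Y x)\<^sup>2 \<le> 2 * u * \<sigma>\<^sup>2 + 2 * u * (W x)\<^sup>2" if "x \<in> space M" for x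
    proof -
      have "(Y x)\<^sup>2 + (Z x + e)\<^sup>2 = 2 * (Z x)\<^sup>2 + 2 * e\<^sup>2"
        by (simp add: Y_def power2_eq_square algebra_simps)
      moreover have "(Z x)\<^sup>2 \<le> (W x)\<^sup>2" using ZW[OF that] by (simp add: abs_le_square_iff)
      moreover have "0 \<le> (Z x + e)\<^sup>2" by simp
      ultimately have "(Y x)\<^sup>2 \<le> 2 * \<sigma>\<^sup>2 + 2 * (W x)\<^sup>2" using e by linarith
      from mult_left_mono[OF this u(1)] show ?thesis by (simp add: algebra_simps)
    qed
    then have "(\<integral>\<^sup>+x. ennreal (exp (u * (Y x)\<^sup>2)) \<partial>M) \<le>
      (\<integral>\<^sup>+x. ennreal (exp (2 * u * \<sigma>\<^sup>2)) * ennreal (exp ((2 * u) * (W x)\<^sup>2)) \<partial>M)"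
      by (intro nn_integral_mono) (auto simp: ennreal_mult[symmetric] exp_add[symmetric] intro!: ennreal_leI)
    also have "\<dots> = ennreal (exp (2 * u * \<sigma>\<^sup>2)) * (\<integral>\<^sup>+x. ennreal (exp ((2 * u) * (W x)\<^sup>2)) \<partial>M)"
      by (rule nn_integral_cmult) simp
    also have "\<dots> \<le> ennreal (exp (2 * u * \<sigma>\<^sup>2)) * ennreal (exp (2 * (2 * u) * \<sigma>\<^sup>2))"
      using nn_integral_exp_square_normal[OF W \<open>0 < \<sigma>\<close>, of "2 * u"] u by (intro mult_left_mono) auto
    also have "\<dots> = ennreal (exp (6 * u * \<sigma>\<^sup>2))"
      by (simp add: ennreal_mult[symmetric] exp_add[symmetric])
    finally show ?thesis .
  qed
  have "(\<integral>\<^sup>+x. ennreal (exp (l * Y x)) \<partial>M) \<le> ennreal (exp (8 * l\<^sup>2 * \<sigma>\<^sup>2))"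
  proof (cases "8 * l\<^sup>2 * \<sigma>\<^sup>2 \<le> 1")
    case True
    then have fin: "(\<integral>\<^sup>+x. ennreal (exp ((l * Y x)\<^sup>2)) \<partial>M) \<le> ennreal (exp (6 * l\<^sup>2 * \<sigma>\<^sup>2))"
      using Y2[of "l\<^sup>2"] by (simp add: power_mult_distrib)
    have int2: "integrable M (\<lambda>x. exp ((l * Y x)\<^sup>2))"
      using fin by (intro integrableI_bounded) (auto simp: top_unique less_top le_less_trans)
    have le: "exp (l * Y x) \<le> l * Y x + exp ((l * Y x)\<^sup>2)" for x by (rule exp_le_add_exp_square)
    have int1: "integrable M (\<lambda>x. exp (l * Y x))"
    proof (rule Bochner_Integration.integrable_bound)
      show "integrable M (\<lambda>x. l * Y x + exp ((l * Y x)\<^sup>2))" using intY int2 by simp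
      show "AE x in M. norm (exp (l * Y x)) \<le> norm (l * Y x + exp ((l * Y x)\<^sup>2))"
        using order_trans[OF le abs_ge_self] by simp
    qed simp
    have "(\<integral>\<^sup>+x. ennreal (exp (l * Y x)) \<partial>M) = ennreal (expectation (\<lambda>x. exp (l * Y x)))"
      using int1 by (intro nn_integral_eq_integral) auto
    also have "expectation (\<lambda>x. exp (l * Y x)) \<le> expectation (\<lambda>x. l * Y x + exp ((l * Y x)\<^sup>2))"
      using int1 int2 intY le by (intro integral_mono) auto
    also have "\<dots> = expectation (\<lambda>x. exp ((l * Y x)\<^sup>2))"
      using int2 intY by simp
    also have "ennreal \<dots> = (\<integral>\<^sup>+x. ennreal (exp ((l * Y x)\<^sup>2)) \<partial>M)"
      using int2 by (intro nn_integral_eq_integral[symmetric]) auto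
    also have "\<dots> \<le> ennreal (exp (6 * l\<^sup>2 * \<sigma>\<^sup>2))" by (rule fin)
    also have "\<dots> \<le> ennreal (exp (8 * l\<^sup>2 * \<sigma>\<^sup>2))" by (intro ennreal_leI) simp
    finally show ?thesis by (simp add: ennreal_leI)
  next
    case False
    \<comment> \<open>The largest exponent that \<open>Y2\<close> admits. In this case
      \<open>u < l\<^sup>2\<close>, so \<open>6 * u\<close> and \<open>2 * l\<^sup>2\<close>
      together stay below \<open>8 * l\<^sup>2\<close>.\<close>
    define u where "u = 1 / (8 * \<sigma>\<^sup>2)"
    have u: "0 \<le> u" "8 * u * \<sigma>\<^sup>2 = 1" using \<open>0 < \<sigma>\<close> by (simp_all add: u_def)
    have "l * Y x \<le> 2 * l\<^sup>2 * \<sigma>\<^sup>2 + u * (Y x)\<^sup>2" for x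
    proof -
      \<comment> \<open>Young's inequality as a completed square.\<close>
      have "0 \<le> 8 * (l * \<sigma> / 2 - Y x / (8 * \<sigma>)) ^ 2 + l\<^sup>2 * \<sigma>\<^sup>2 * 0" by simp
      also have "8 * (l * \<sigma> / 2 - Y x / (8 * \<sigma>)) ^ 2 = 2 * l\<^sup>2 * \<sigma>\<^sup>2 - l * Y x + u * (Y x)\<^sup>2"
        using \<open>0 < \<sigma>\<close> by (simp add: u_def power2_eq_square field_simps)
      finally show ?thesis by simp
    qed
    then have "(\<integral>\<^sup>+x. ennreal (exp (l * Y x)) \<partial>M) \<le>
      (\<integral>\<^sup>+x. ennreal (exp (2 * l\<^sup>2 * \<sigma>\<^sup>2)) * ennreal (exp (u * (Y x)\<^sup>2)) \<partial>M)"
      by (intro nn_integral_mono) (auto simp: ennreal_mult[symmetric] exp_add[symmetric] intro!: ennreal_leI)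
    also have "\<dots> = ennreal (exp (2 * l\<^sup>2 * \<sigma>\<^sup>2)) * (\<integral>\<^sup>+x. ennreal (exp (u * (Y x)\<^sup>2)) \<partial>M)"
      by (rule nn_integral_cmult) simp
    also have "\<dots> \<le> ennreal (exp (2 * l\<^sup>2 * \<sigma>\<^sup>2)) * ennreal (exp (6 * u * \<sigma>\<^sup>2))"
      using Y2[of u] u by (intro mult_left_mono) auto
    also have "\<dots> = ennreal (exp (2 * l\<^sup>2 * \<sigma>\<^sup>2 + 6 * u * \<sigma>\<^sup>2))"
      by (simp add: ennreal_mult[symmetric] exp_add[symmetric])
    also have "\<dots> \<le> ennreal (exp (8 * l\<^sup>2 * \<sigma>\<^sup>2))"
    proof -
      have "2 * l\<^sup>2 * \<sigma>\<^sup>2 + 6 * u * \<sigma>\<^sup>2 \<le> 8 * l\<^sup>2 * \<sigma>\<^sup>2" using False u by linarith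
      then show ?thesis by (intro ennreal_leI) (simp only: exp_le_cancel_iff)
    qed
    finally show ?thesis .
  qed
  then show ?thesis by (simp add: Y_def e_def)
qed

section \<open>Gaussian measurements and increments of the centered process\<close>

lemma prob_space_gaussian_tensor: "prob_space (gaussian_tensor N d)"
  unfolding gaussian_tensor_def by (intro prob_space_PiM prob_space_std_normal)

lemma prob_space_gaussian_measurements: "prob_space (gaussian_measurements N d m)"
  unfolding gaussian_measurements_def by (intro prob_space_PiM prob_space_gaussian_tensor)

lemma borel_measurable_tensor_inner:
  "(\<lambda>A. tensor_inner N d A X) \<in> borel_measurable (gaussian_tensor N d)"
  unfolding tensor_inner_def gaussian_tensor_def
  by (intro borel_measurable_sum borel_measurable_times measurable_std_normal_coordinate) auto

lemma borel_measurable_measurement: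
  assumes "k \<in> {1..m}"
  shows "(\<lambda>A. tensor_inner N d (A k) X) \<in> borel_measurable (gaussian_measurements N d m)"
  unfolding gaussian_measurements_def
  by (rule measurable_compose[OF measurable_component_singleton[OF assms] borel_measurable_tensor_inner])

lemma tensor_inner_diff: "tensor_inner N d A (X - Y) = tensor_inner N d A X - tensor_inner N d A Y"
  by (simp add: tensor_inner_def right_diff_distrib sum_subtractf)

lemma frob_norm_nonneg [simp]: "0 \<le> frob_norm N d X"
  by (simp add: frob_norm_eq_L2_set)

lemma distributed_tensor_inner:
  assumes "0 < frob_norm N d X"
  shows "distributed (gaussian_tensor N d) lborel (\<lambda>A. tensor_inner N d A X) (normal_density 0 (frob_norm N d X))"
  using distributed_linear_std_normal[OF finite_multi_indices, of X N d] assms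
  by (simp add: gaussian_tensor_def tensor_inner_def[abs_def] frob_norm_eq_L2_set)

lemma tensor_inner_eq_if_frob_norm_zero:
  assumes "frob_norm N d (X - Y) = 0"
  shows "tensor_inner N d A X = tensor_inner N d A Y" "frob_norm N d X = frob_norm N d Y"
proof -
  have "\<forall>j\<in>multi_indices N d. X j = Y j"
    using assms by (simp add: frob_norm_eq_L2_set L2_set_eq_0_iff)
  then show "tensor_inner N d A X = tensor_inner N d A Y" "frob_norm N d X = frob_norm N d Y"
    by (simp_all add: tensor_inner_def frob_norm_def)
qed

lemma expectation_abs_tensor_inner:
  "integrable (gaussian_tensor N d) (\<lambda>A. \<bar>tensor_inner N d A X\<bar>)"
  "(\<integral>A. \<bar>tensor_inner N d A X\<bar> \<partial>gaussian_tensor N d) = sqrt (2 / pi) * frob_norm N d X"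
proof -
  interpret prob_space "gaussian_tensor N d" by (rule prob_space_gaussian_tensor)
  have "integrable (gaussian_tensor N d) (\<lambda>A. \<bar>tensor_inner N d A X\<bar>) \<and>
    (\<integral>A. \<bar>tensor_inner N d A X\<bar> \<partial>gaussian_tensor N d) = sqrt (2 / pi) * frob_norm N d X"
  proof (cases "frob_norm N d X = 0")
    case True
    then have "\<forall>j\<in>multi_indices N d. X j = 0"
      by (simp add: frob_norm_eq_L2_set L2_set_eq_0_iff)
    then have "tensor_inner N d A X = 0" for A by (simp add: tensor_inner_def)
    then show ?thesis using True by simp
  next
    case False
    then have "0 < frob_norm N d X" using frob_norm_nonneg[of N d X] by linarith
    from expectation_abs_normal[OF distributed_tensor_inner[OF this] this]
    show ?thesis by (simp add: mult.commute)
  qed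
  then show "integrable (gaussian_tensor N d) (\<lambda>A. \<bar>tensor_inner N d A X\<bar>)"
    "(\<integral>A. \<bar>tensor_inner N d A X\<bar> \<partial>gaussian_tensor N d) = sqrt (2 / pi) * frob_norm N d X" by auto
qed

text \<open>The process that is chained. Under Gaussian measurements, subtracting the mean within
  each summand centers it for every \<open>X\<close> at once, whatever the signs.\<close>

definition centered_sum ::
    "nat \<Rightarrow> (nat \<Rightarrow> nat) \<Rightarrow> nat \<Rightarrow> (nat \<Rightarrow> real) \<Rightarrow> (nat \<Rightarrow> tensor) \<Rightarrow> tensor \<Rightarrow> real" where
  "centered_sum N d m \<epsilon> A X =
     (\<Sum>k=1..m. \<epsilon> k * (\<bar>tensor_inner N d (A k) X\<bar> - sqrt (2 / pi) * frob_norm N d X))"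

lemma borel_measurable_centered_sum:
  "(\<lambda>A. centered_sum N d m \<epsilon> A X) \<in> borel_measurable (gaussian_measurements N d m)"
  unfolding centered_sum_def
  by (intro borel_measurable_sum borel_measurable_times borel_measurable_const borel_measurable_diff
      borel_measurable_abs borel_measurable_measurement)

text \<open>By the reverse triangle inequality the signed increment is dominated by
  \<open>tensor_inner N d A (X - Y)\<close>, a normal variable whose deviation is the Frobenius
  distance. The terms subtracted in \<open>f\<close> are exactly the expectations of the absolute
  values.\<close>

lemma increment_mgf:
  assumes \<sigma>: "0 < frob_norm N d (X - Y)" and \<epsilon>: "\<bar>\<epsilon>\<bar> \<le> 1"
  defines "f \<equiv> \<lambda>A X. \<epsilon> * (\<bar>tensor_inner N d A X\<bar> - sqrt (2 / pi) * frob_norm N d X)"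
  shows "(\<integral>\<^sup>+A. ennreal (exp (l * (f A X - f A Y))) \<partial>gaussian_tensor N d)
    \<le> ennreal (exp (8 * l\<^sup>2 * (frob_norm N d (X - Y))\<^sup>2))"
proof -
  interpret prob_space "gaussian_tensor N d" by (rule prob_space_gaussian_tensor)
  define Z where "Z A = \<epsilon> * (\<bar>tensor_inner N d A X\<bar> - \<bar>tensor_inner N d A Y\<bar>)" for A
  have Zm: "Z \<in> borel_measurable (gaussian_tensor N d)"
    unfolding Z_def[abs_def]
    by (intro borel_measurable_times borel_measurable_const borel_measurable_diff
      borel_measurable_abs borel_measurable_tensor_inner)
  have "\<bar>Z A\<bar> \<le> \<bar>tensor_inner N d A (X - Y)\<bar>" for A
  proof -
    have "\<bar>Z A\<bar> \<le> 1 * \<bar>\<bar>tensor_inner N d A X\<bar> - \<bar>tensor_inner N d A Y\<bar>\<bar>"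
      unfolding Z_def abs_mult using \<epsilon> by (intro mult_right_mono) auto
    then show ?thesis by (simp add: tensor_inner_diff)
  qed
  from mgf_le_if_dominated_by_normal[OF distributed_tensor_inner[OF \<sigma>] \<sigma> Zm this, of l]
  have "(\<integral>\<^sup>+A. ennreal (exp (l * (Z A - expectation Z))) \<partial>gaussian_tensor N d)
    \<le> ennreal (exp (8 * l\<^sup>2 * (frob_norm N d (X - Y))\<^sup>2))" .
  moreover have "expectation Z = \<epsilon> * (sqrt (2 / pi) * frob_norm N d X - sqrt (2 / pi) * frob_norm N d Y)"
    unfolding Z_def[abs_def] by (simp add: expectation_abs_tensor_inner)
  then have "Z A - expectation Z = f A X - f A Y" for A
    by (simp add: Z_def f_def algebra_simps)
  ultimately show ?thesis by simp
qed

text \<open>Chernoff's method: the product measure turns the integral of the exponential of a sum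
  into a product of integrals, one for each measurement.\<close>

lemma increment_tail:
  assumes \<epsilon>: "\<And>k. \<bar>\<epsilon> k\<bar> \<le> 1" and "0 < t"
  shows "measure (gaussian_measurements N d m)
    {A \<in> space (gaussian_measurements N d m).
      m * t * frob_norm N d (X - Y) < centered_sum N d m \<epsilon> A X - centered_sum N d m \<epsilon> A Y}
    \<le> exp (- (m * t\<^sup>2 / 32))"
proof -
  let ?G = "gaussian_measurements N d m" and ?M = "gaussian_tensor N d"
  let ?\<sigma> = "frob_norm N d (X - Y)"
  let ?F = "\<lambda>A. centered_sum N d m \<epsilon> A X - centered_sum N d m \<epsilon> A Y"
  interpret prob_space ?G by (rule prob_space_gaussian_measurements)
  show ?thesis
  proof (cases "?\<sigma> = 0")
    \<comment> \<open>The strict inequality makes the event empty here.\<close>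
    case True
    then have "?F A = 0" for A
      using tensor_inner_eq_if_frob_norm_zero[OF True] by (simp add: centered_sum_def)
    then show ?thesis using True by simp
  next
    case False
    then have \<sigma>: "0 < ?\<sigma>" using frob_norm_nonneg[of N d "X - Y"] by linarith
    \<comment> \<open>The minimizer of
      \<open>8 * l\<^sup>2 * ?\<sigma>\<^sup>2 - l * t * ?\<sigma>\<close>, with minimum
      \<open>- t\<^sup>2 / 32\<close>.\<close>
    define l where "l = t / (16 * ?\<sigma>)"
    define f where "f k A X = \<epsilon> k * (\<bar>tensor_inner N d A X\<bar> - sqrt (2 / pi) * frob_norm N d X)" for k A X
    have l: "0 < l" using \<open>0 < t\<close> \<sigma> by (simp add: l_def)
    have Fm: "?F \<in> borel_measurable ?G"
      by (intro borel_measurable_diff borel_measurable_centered_sum)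
    have F: "?F A = (\<Sum>k=1..m. f k (A k) X - f k (A k) Y)" for A
      by (simp add: centered_sum_def f_def sum_subtractf)
    have fm: "(\<lambda>A. ennreal (exp (l * (f k A X - f k A Y)))) \<in> borel_measurable ?M" for k
      unfolding f_def
      by (intro measurable_compose[OF _ measurable_ennreal] measurable_compose[OF _ borel_measurable_exp]
        borel_measurable_times borel_measurable_const borel_measurable_diff
        borel_measurable_abs borel_measurable_tensor_inner)
    interpret product_sigma_finite "\<lambda>_. ?M"
      using prob_space_gaussian_tensor[THEN prob_space_imp_sigma_finite] by (simp add: product_sigma_finite_def)
    have "(\<integral>\<^sup>+A. ennreal (exp (l * ?F A)) \<partial>?G) =
      (\<integral>\<^sup>+A. (\<Prod>k\<in>{1..m}. ennreal (exp (l * (f k (A k) X - f k (A k) Y)))) \<partial>?G)"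
      unfolding F by (intro nn_integral_cong) (simp add: sum_distrib_left exp_sum prod_ennreal)
    also have "\<dots> = (\<Prod>k\<in>{1..m}. \<integral>\<^sup>+A. ennreal (exp (l * (f k A X - f k A Y))) \<partial>?M)"
      unfolding gaussian_measurements_def using fm by (intro product_nn_integral_prod) auto
    also have "\<dots> \<le> (\<Prod>k\<in>{1..m}. ennreal (exp (8 * l\<^sup>2 * ?\<sigma>\<^sup>2)))"
      unfolding f_def using increment_mgf[OF \<sigma> \<epsilon>] by (intro prod_mono_ennreal) auto
    also have "\<dots> = ennreal (exp (8 * l\<^sup>2 * ?\<sigma>\<^sup>2) ^ m)" by (simp add: ennreal_power)
    finally have mgf: "(\<integral>\<^sup>+A. ennreal (exp (l * ?F A)) \<partial>?G) \<le> ennreal (exp (m * (8 * l\<^sup>2 * ?\<sigma>\<^sup>2)))"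
      by (simp add: exp_of_nat_mult)
    have "emeasure ?G {A \<in> space ?G. m * t * ?\<sigma> < ?F A} \<le> emeasure ?G {A \<in> space ?G. m * t * ?\<sigma> \<le> ?F A}"
      using Fm by (intro emeasure_mono) auto
    also have "\<dots> \<le> ennreal (exp (- l * (m * t * ?\<sigma>))) *
        (\<integral>\<^sup>+A. ennreal (exp (l * ?F A)) * indicator (space ?G) A \<partial>?G)"
      using Fm by (intro Chernoff_ineq_nn_integral_ge l) auto
    also have "\<dots> = ennreal (exp (- l * (m * t * ?\<sigma>))) * (\<integral>\<^sup>+A. ennreal (exp (l * ?F A)) \<partial>?G)"
      by (intro arg_cong2[of _ _ _ _ "(*)"] nn_integral_cong refl) auto
    also have "\<dots> \<le> ennreal (exp (- l * (m * t * ?\<sigma>))) * ennreal (exp (m * (8 * l\<^sup>2 * ?\<sigma>\<^sup>2)))"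
      by (rule mult_left_mono[OF mgf]) simp
    also have "\<dots> = ennreal (exp (- l * (m * t * ?\<sigma>) + m * (8 * l\<^sup>2 * ?\<sigma>\<^sup>2)))"
      by (simp add: ennreal_mult[symmetric] exp_add[symmetric])
    also have "- l * (m * t * ?\<sigma>) + m * (8 * l\<^sup>2 * ?\<sigma>\<^sup>2) = - (m * t\<^sup>2 / 32)"
      using \<sigma> by (simp add: l_def power2_eq_square field_simps)
    finally show ?thesis unfolding emeasure_eq_measure by (simp only: ennreal_le_iff exp_ge_zero)
  qed
qed

subsection \<open>Chaining\<close>

lemma tendsto_tensor_inner:
  assumes "\<And>j. j \<in> multi_indices N d \<Longrightarrow> (\<lambda>n. Y n j) \<longlonglongrightarrow> X j"
  shows "(\<lambda>n. tensor_inner N d A (Y n)) \<longlonglongrightarrow> tensor_inner N d A X"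
  unfolding tensor_inner_def by (intro tendsto_sum tendsto_mult tendsto_const assms)

lemma tendsto_frob_norm:
  assumes "\<And>j. j \<in> multi_indices N d \<Longrightarrow> (\<lambda>n. Y n j) \<longlonglongrightarrow> X j"
  shows "(\<lambda>n. frob_norm N d (Y n)) \<longlonglongrightarrow> frob_norm N d X"
  unfolding frob_norm_def tensor_inner_def by (intro tendsto_real_sqrt tendsto_sum tendsto_mult assms)

lemma frob_norm_diff_triangle: "frob_norm N d (X - Y) \<le> frob_norm N d (Z - X) + frob_norm N d (Z - Y)"
proof -
  have "L2_set (X - Y) (multi_indices N d) =
      L2_set (\<lambda>j. (-1) * (Z - X) j + (Z - Y) j) (multi_indices N d)"
    by (simp add: algebra_simps fun_diff_def)
  also have "\<dots> \<le> L2_set (\<lambda>j. (-1) * (Z - X) j) (multi_indices N d) + L2_set (\<lambda>j. (Z - Y) j) (multi_indices N d)"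
    by (rule L2_set_triangle_ineq)
  finally show ?thesis by (simp only: L2_set_abs_scale frob_norm_eq_L2_set)
qed

lemma sum_Suc_half_pow: "(\<Sum>k<n. real (Suc k) * (1/2) ^ k) = 4 - (2 * real n + 4) * (1/2) ^ n"
proof (induction n)
  case (Suc n)
  have "4 - (2 * a + 4) * x + (1 + a) * x = 4 - (2 * (1 + a) + 4) * (1/2 * x)" for a x :: real
    by (simp add: field_simps)
  then show ?case by (simp only: sum.lessThan_Suc Suc of_nat_Suc[of n] power_Suc)
qed simp

text \<open>The deterministic half of chaining: all randomness sits in \<open>incr\<close>. The
  chain starts where the process vanishes, telescopes, and reaches \<open>D\<close> by continuity.
  Links have length at most \<open>2 * (1/2) ^ k\<close>, so the 8 is 2 times the bound 4 on the sum
  of \<open>(k + 1) / 2 ^ k\<close>.\<close>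

lemma chaining_lower_bound:
  fixes \<delta> :: real
  assumes T0: "T 0 = {\<lambda>_. 0}"
    and net: "\<And>k. \<exists>t\<in>T k. frob_norm N d (D - t) \<le> (1/2) ^ k"
    and incr: "\<And>k t t'. t \<in> T k \<Longrightarrow> t' \<in> T (Suc k) \<Longrightarrow>
      centered_sum N d m \<epsilon> A t - centered_sum N d m \<epsilon> A t' \<le> m * (\<delta> * Suc k / 8) * frob_norm N d (t - t')"
    and "0 \<le> \<delta>"
  shows "- (m * \<delta>) \<le> centered_sum N d m \<epsilon> A D"
proof -
  let ?h = "centered_sum N d m \<epsilon> A"
  from net obtain p where p: "\<And>k. p k \<in> T k" "\<And>k. frob_norm N d (D - p k) \<le> (1/2) ^ k" by metis
  have "?h (p k) - ?h (p (Suc k)) \<le> m * \<delta> / 4 * (Suc k * (1/2) ^ k)" for k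
  proof -
    have "frob_norm N d (p k - p (Suc k)) \<le> 2 * (1/2) ^ k"
      using frob_norm_diff_triangle[of N d "p k" "p (Suc k)" D] p(2)[of k]
        order_trans[OF p(2)[of "Suc k"] power_decreasing[of k "Suc k" "1/2::real"]] by simp
    then have "m * (\<delta> * Suc k / 8) * frob_norm N d (p k - p (Suc k)) \<le> m * (\<delta> * Suc k / 8) * (2 * (1/2) ^ k)"
      using \<open>0 \<le> \<delta>\<close> by (intro mult_left_mono) auto
    also have "\<dots> = m * \<delta> / 4 * (Suc k * (1/2) ^ k)" by simp
    finally show ?thesis using incr[OF p(1) p(1), of k] by linarith
  qed
  then have 1: "(\<Sum>k<n. ?h (p k) - ?h (p (Suc k))) \<le> (\<Sum>k<n. m * \<delta> / 4 * (Suc k * (1/2) ^ k))" for n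
    by (intro sum_mono)
  have 2: "(\<Sum>k<n. ?h (p k) - ?h (p (Suc k))) = ?h (p 0) - ?h (p n)" for n
    by (induction n) auto
  have 3: "(\<Sum>k<n. m * \<delta> / 4 * (Suc k * (1/2) ^ k)) \<le> m * \<delta>" for n
  proof -
    have "(\<Sum>k<n. m * \<delta> / 4 * (Suc k * (1/2) ^ k)) = m * \<delta> / 4 * (4 - (2 * real n + 4) * (1/2) ^ n)"
      by (simp only: sum_distrib_left[symmetric] sum_Suc_half_pow)
    also have "\<dots> \<le> m * \<delta> / 4 * 4"
      using \<open>0 \<le> \<delta>\<close> by (intro mult_left_mono) auto
    finally show ?thesis by simp
  qed
  have 4: "?h (p 0) = 0"
    using p(1)[of 0] by (simp add: T0 centered_sum_def tensor_inner_def frob_norm_def)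
  have low: "- (m * \<delta>) \<le> ?h (p n)" for n
    using 1[of n] 2[of n] 3[of n] 4 by linarith
  have lim: "(\<lambda>n. p n j) \<longlonglongrightarrow> D j" if "j \<in> multi_indices N d" for j
  proof (rule LIMSEQ_I)
    fix r :: real assume "0 < r"
    then obtain n0 where n0: "(1/2) ^ n0 < r" using real_arch_pow_inv[of r "1/2"] by auto
    have "norm (p n j - D j) < r" if "n0 \<le> n" for n
    proof -
      have "\<bar>(D - p n) j\<bar> \<le> frob_norm N d (D - p n)"
        unfolding frob_norm_eq_L2_set using \<open>j \<in> _\<close> by (intro abs_le_L2_set) auto
      also have "\<dots> \<le> (1/2) ^ n" by (rule p(2))
      also have "\<dots> \<le> (1/2) ^ n0" using that by (intro power_decreasing) auto
      finally show ?thesis using n0 by (simp add: abs_minus_commute)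
    qed
    then show "\<exists>n0. \<forall>n\<ge>n0. norm (p n j - D j) < r" by blast
  qed
  have "(\<lambda>n. ?h (p n)) \<longlonglongrightarrow> ?h D"
    unfolding centered_sum_def
    by (intro tendsto_sum tendsto_mult tendsto_diff tendsto_const tendsto_rabs
        tendsto_tensor_inner tendsto_frob_norm lim)
  then show ?thesis using low by (intro LIMSEQ_le_const) auto
qed

text \<open>A weighted union bound: level \<open>k\<close> may fail with probability
  \<open>q * (1/2) ^ (k + 1)\<close>, and these weights sum to \<open>q\<close>. One exceptional set
  thus serves all levels.\<close>

lemma chaining_tail:
  fixes \<delta> q :: real
  assumes \<epsilon>: "\<And>k. \<bar>\<epsilon> k\<bar> \<le> 1" and "0 < \<delta>" and fin: "\<And>k. finite (T k)"
    and small: "\<And>k. card (T k) * card (T (Suc k)) * exp (- (m * (\<delta> * Suc k / 8)\<^sup>2 / 32)) \<le> q * (1/2) ^ Suc k"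
  obtains B where "B \<in> sets (gaussian_measurements N d m)" "measure (gaussian_measurements N d m) B \<le> q"
    "\<forall>A\<in>space (gaussian_measurements N d m) - B. \<forall>k. \<forall>t\<in>T k. \<forall>t'\<in>T (Suc k).
      centered_sum N d m \<epsilon> A t - centered_sum N d m \<epsilon> A t' \<le> m * (\<delta> * Suc k / 8) * frob_norm N d (t - t')"
proof -
  let ?G = "gaussian_measurements N d m" and ?h = "centered_sum N d m \<epsilon>"
  interpret prob_space ?G by (rule prob_space_gaussian_measurements)
  define B where "B k p = {A \<in> space ?G. m * (\<delta> * Suc k / 8) * frob_norm N d (fst p - snd p) < ?h A (fst p) - ?h A (snd p)}"
    for k p
  define C where "C k = (\<Union>p\<in>T k \<times> T (Suc k). B k p)" for k
  have B: "B k p \<in> sets ?G" for k p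
    unfolding B_def by (intro borel_measurable_less borel_measurable_const borel_measurable_diff borel_measurable_centered_sum)
  have C: "C k \<in> sets ?G" for k
    unfolding C_def using fin B by (intro sets.finite_UN) auto
  have mC: "measure ?G (C k) \<le> q * (1/2) ^ Suc k" for k
  proof -
    have "measure ?G (C k) \<le> (\<Sum>p\<in>T k \<times> T (Suc k). measure ?G (B k p))"
      unfolding C_def using fin B by (intro measure_UNION_le) auto
    also have "\<dots> \<le> (\<Sum>p\<in>T k \<times> T (Suc k). exp (- (m * (\<delta> * Suc k / 8)\<^sup>2 / 32)))"
      unfolding B_def using \<epsilon> \<open>0 < \<delta>\<close> by (intro sum_mono increment_tail) auto
    also have "\<dots> = card (T k) * card (T (Suc k)) * exp (- (m * (\<delta> * Suc k / 8)\<^sup>2 / 32))"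
      by (simp add: card_cartesian_product)
    finally show ?thesis using small[of k] by linarith
  qed
  have geo: "(\<lambda>k. q * (1/2) ^ Suc k) sums q"
    using sums_mult[OF power_half_series, of q] by simp
  have sumC: "summable (\<lambda>k. measure ?G (C k))"
    by (rule summable_comparison_test'[OF sums_summable[OF geo], of 0]) (use mC in auto)
  have "measure ?G (\<Union>k. C k) \<le> (\<Sum>k. measure ?G (C k))"
    using C sumC by (intro finite_measure_subadditive_countably) auto
  also have "\<dots> \<le> (\<Sum>k. q * (1/2) ^ Suc k)"
    using mC sumC sums_summable[OF geo] by (rule suminf_le)
  also have "\<dots> = q" using geo by (rule sums_unique[symmetric])
  finally have "measure ?G (\<Union>k. C k) \<le> q" .
  moreover have "?h A t - ?h A t' \<le> m * (\<delta> * Suc k / 8) * frob_norm N d (t - t')"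
    if "A \<in> space ?G - (\<Union>k. C k)" "t \<in> T k" "t' \<in> T (Suc k)" for A k t t'
  proof -
    have "A \<notin> B k (t, t')" "A \<in> space ?G" using that by (auto simp: C_def)
    then show ?thesis by (simp add: B_def)
  qed
  moreover have "(\<Union>k. C k) \<in> sets ?G" using C by auto
  ultimately show ?thesis by (intro that[of "\<Union>k. C k"]) auto
qed

section \<open>Measurability of events that quantify over all tensors\<close>

text \<open>Real functions on the naturals form a second countable space, so each of its subsets is
  separable. An enumeration of the finite \<open>J\<close> transfers this to an index type of any
  size. \<open>T\<close> must lie inside \<open>S\<close>, since the property in question is known
  only there.\<close>

lemma ex_countable_dense_subset_pointwise:
  fixes S :: "('j \<Rightarrow> real) set"
  assumes "finite J"
  obtains T where "countable T" "T \<subseteq> S"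
    "\<And>X. X \<in> S \<Longrightarrow> \<exists>Y. (\<forall>n. Y n \<in> T) \<and> (\<forall>j\<in>J. (\<lambda>n. Y n j) \<longlonglongrightarrow> X j)"
proof -
  obtain e where e: "bij_betw e {..<card J} J"
    using ex_bij_betw_nat_finite[OF assms] by (auto simp: lessThan_atLeast0)
  define enc :: "('j \<Rightarrow> real) \<Rightarrow> nat \<Rightarrow> real" where "enc X i = X (e i)" for X i
  obtain U where U: "countable U" "U \<subseteq> enc ` S" "enc ` S \<subseteq> closure U"
    by (rule separable)
  then obtain T where T: "countable T" "T \<subseteq> S" "U = enc ` T"
    using countable_subset_image[of U enc S] by blast
  have "\<exists>Y. (\<forall>n. Y n \<in> T) \<and> (\<forall>j\<in>J. (\<lambda>n. Y n j) \<longlonglongrightarrow> X j)" if "X \<in> S" for X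
  proof -
    have "enc X \<in> closure (enc ` T)" using that U T by auto
    then obtain u where u: "\<And>n. u n \<in> enc ` T" "u \<longlonglongrightarrow> enc X"
      by (auto simp: closure_sequential)
    have "\<forall>n. \<exists>Y. Y \<in> T \<and> u n = enc Y" using u(1) by auto
    then obtain Y where Y: "\<And>n. Y n \<in> T" "\<And>n. u n = enc (Y n)" by metis
    have "(\<lambda>n. Y n j) \<longlonglongrightarrow> X j" if j: "j \<in> J" for j
    proof -
      obtain i where i: "j = e i" using e j by (auto simp: bij_betw_def)
      have "continuous_on UNIV (\<lambda>f::nat \<Rightarrow> real. f i)" by simp
      then have "((\<lambda>f::nat \<Rightarrow> real. f i) \<longlongrightarrow> enc X i) (at (enc X))"
        by (simp add: continuous_on_def)
      from tendsto_compose[OF this u(2)] show ?thesis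
        by (simp add: i Y(2) enc_def)
    qed
    with Y(1) show ?thesis by blast
  qed
  with T show ?thesis by (intro that[of T]) auto
qed

text \<open>The quantifier ranges over uncountably many tensors, and continuity in \<open>X\<close>
  reduces it to a countable dense set. Measurability is essential: \<open>measure\<close> is 0 by
  default outside the sigma-algebra, which would void any lower bound.\<close>

lemma sets_Collect_all_continuous:
  fixes g :: "(nat \<Rightarrow> tensor) \<Rightarrow> tensor \<Rightarrow> real"
  assumes meas: "\<And>X. (\<lambda>A. g A X) \<in> borel_measurable (gaussian_measurements N d m)"
    and cont: "\<And>A X Y. (\<And>j. j \<in> multi_indices N d \<Longrightarrow> (\<lambda>n. Y n j) \<longlonglongrightarrow> X j) \<Longrightarrow> (\<lambda>n. g A (Y n)) \<longlonglongrightarrow> g A X"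
  shows "{A \<in> space (gaussian_measurements N d m). \<forall>X. P X \<longrightarrow> 0 \<le> g A X} \<in> sets (gaussian_measurements N d m)"
proof -
  let ?G = "gaussian_measurements N d m"
  obtain T where T: "countable T" "T \<subseteq> Collect P"
    "\<And>X. X \<in> Collect P \<Longrightarrow> \<exists>Y. (\<forall>n. Y n \<in> T) \<and> (\<forall>j\<in>multi_indices N d. (\<lambda>n. Y n j) \<longlonglongrightarrow> X j)"
    using ex_countable_dense_subset_pointwise[OF finite_multi_indices, of "Collect P" N d] by blast
  have "(\<forall>X. P X \<longrightarrow> 0 \<le> g A X) \<longleftrightarrow> (\<forall>X\<in>T. 0 \<le> g A X)" for A
  proof
    assume *: "\<forall>X\<in>T. 0 \<le> g A X"
    show "\<forall>X. P X \<longrightarrow> 0 \<le> g A X"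
    proof (intro allI impI)
      fix X assume "P X"
      then obtain Y where Y: "\<And>n. Y n \<in> T" "\<And>j. j \<in> multi_indices N d \<Longrightarrow> (\<lambda>n. Y n j) \<longlonglongrightarrow> X j"
        using T(3)[of X] by auto
      show "0 \<le> g A X"
        using cont[where A = A and X = X and Y = Y, OF Y(2)] * Y(1) by (intro LIMSEQ_le_const) auto
    qed
  qed (use T(2) in auto)
  moreover have "{A \<in> space ?G. \<forall>X\<in>T. 0 \<le> g A X} \<in> sets ?G"
    using T(1) meas by (intro sets.sets_Collect_countable_All' borel_measurable_le) auto
  ultimately show ?thesis by simp
qed

subsection \<open>Sharpness\<close>

text \<open>Makes the zero tensor alone a net at resolution 1, the starting level of the
  chain.\<close>

lemma frob_norm_tt_row_le:
  assumes "factors_le N d R 1 Q" "0 < R"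
  shows "frob_norm N d (\<lambda>j. tt_row R Q j N 0) \<le> 1"
proof -
  have "(\<Sum>b<R. f b * (if b = 0 then 1 else 0)) = f 0" for f :: "nat \<Rightarrow> real"
    using \<open>0 < R\<close> by (simp add: if_distrib[of "\<lambda>y. _ * y"] cong: if_cong)
  with tt_row_norm_le[OF assms(1) order_refl assms(2), of "\<lambda>b. if b = 0 then 1 else 0"] assms(2)
  show ?thesis by (simp add: frob_norm_eq_L2_set L2_set_unit)
qed

definition outlier_sign :: "(nat \<Rightarrow> real) \<Rightarrow> nat \<Rightarrow> real" where
  "outlier_sign s k = (if s k = 0 then 1 else -1)"

lemma sum_outlier_sign:
  assumes "0 < m"
  shows "(\<Sum>k=1..m. outlier_sign s k) = m * (1 - 2 * outlier_fraction m s)"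
proof -
  have "(\<Sum>k=1..m. outlier_sign s k) = (\<Sum>k=1..m. 1 - 2 * (if s k \<noteq> 0 then 1 else 0))"
    by (intro sum.cong) (auto simp: outlier_sign_def)
  also have "\<dots> = m - 2 * (\<Sum>k=1..m. if s k \<noteq> 0 then 1 else (0::real))"
    by (simp only: sum_subtractf sum_distrib_left[symmetric]) simp
  also have "(\<Sum>k=1..m. if s k \<noteq> 0 then 1 else (0::real)) = card (outlier_support m s)"
    by (simp add: outlier_support_def sum.If_cases Int_def)
  also have "m - 2 * real (card (outlier_support m s)) = m * (1 - 2 * outlier_fraction m s)"
    using assms by (simp add: outlier_fraction_def right_diff_distrib)
  finally show ?thesis .
qed

lemma l1_norm_diff_ge:
  "(\<Sum>k=1..m. outlier_sign s k * \<bar>v k\<bar>) \<le> l1_norm m (v - s) - l1_norm m s"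
  unfolding l1_norm_def sum_subtractf[symmetric]
  by (intro sum_mono) (auto simp: outlier_sign_def)

text \<open>Once the outliers are replaced by signs, the inequality is homogeneous in
  \<open>X - Y\<close>. It suffices to know it for a normalized train, where the subtracted mean is
  the sum of the signs times \<open>sqrt (2 / pi)\<close>.\<close>

lemma sharpness_if_centered_sum_ge:
  assumes "0 < m" "2 \<le> N" and r: "tt_ranks N r" "\<And>i. i \<le> N \<Longrightarrow> r i \<le> \<rho>"
    and X: "tt_format N d r X" "tt_format N d r Y"
    and low: "\<And>Q. factors_le N d (2 * \<rho>) 1 Q \<Longrightarrow>
      - (m * \<delta>) \<le> centered_sum N d m (outlier_sign s) A (\<lambda>j. tt_row (2 * \<rho>) Q j N 0)"
  shows "((1 - 2 * outlier_fraction m s) * sqrt (2 / pi) - \<delta>) * frob_norm N d (X - Y)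
    \<le> 1 / real m * l1_norm m (measure_op N d A (X - Y) - s) - 1 / real m * l1_norm m s"
proof -
  let ?f = "frob_norm N d (X - Y)" and ?\<kappa> = "(1 - 2 * outlier_fraction m s) * sqrt (2 / pi)"
  let ?S = "\<lambda>X. \<Sum>k=1..m. outlier_sign s k * \<bar>tensor_inner N d (A k) X\<bar>"
  have main: "m * ((?\<kappa> - \<delta>) * ?f) \<le> ?S (X - Y)"
  proof (cases "?f = 0")
    case True
    then have "\<forall>j\<in>multi_indices N d. (X - Y) j = 0"
      by (simp add: frob_norm_eq_L2_set L2_set_eq_0_iff)
    then have "tensor_inner N d B (X - Y) = 0" for B by (simp add: tensor_inner_def)
    then show ?thesis using True by simp
  next
    case False
    then have f: "0 < ?f" using frob_norm_nonneg[of N d "X - Y"] by linarith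
    obtain Q where Q: "factors_le N d (2 * \<rho>) 1 Q"
      "\<And>j. j \<in> multi_indices N d \<Longrightarrow> (X - Y) j = ?f * tt_row (2 * \<rho>) Q j N 0"
      using tt_diff_normalize[OF \<open>2 \<le> N\<close> r X f] by blast
    let ?U = "\<lambda>j. tt_row (2 * \<rho>) Q j N 0"
    have inner: "tensor_inner N d B (X - Y) = ?f * tensor_inner N d B ?U" for B
      unfolding tensor_inner_def sum_distrib_left by (intro sum.cong refl) (simp only: Q(2) mult_ac)
    \<comment> \<open>The bound on the factors gives only norm at most 1. Equality follows by
      comparing the norms of \<open>X - Y\<close> and \<open>?f\<close> times
      \<open>?U\<close>.\<close>
    have "?f = L2_set (\<lambda>j. ?f * ?U j) (multi_indices N d)"
      unfolding frob_norm_eq_L2_set[of N d "X - Y"] using Q(2)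
      by (intro L2_set_cong refl) (simp only: frob_norm_eq_L2_set)
    also have "\<dots> = ?f * frob_norm N d ?U"
      using f by (simp only: L2_set_abs_scale frob_norm_eq_L2_set abs_of_pos)
    finally have U: "frob_norm N d ?U = 1" using f by simp
    have "- (m * \<delta>) \<le> ?S ?U - (\<Sum>k=1..m. outlier_sign s k) * sqrt (2 / pi)"
      using low[OF Q(1)] U by (simp add: centered_sum_def right_diff_distrib sum_subtractf sum_distrib_right)
    then have "m * (?\<kappa> - \<delta>) \<le> ?S ?U"
      unfolding sum_outlier_sign[OF \<open>0 < m\<close>] by (simp add: algebra_simps)
    then have "?f * (m * (?\<kappa> - \<delta>)) \<le> ?f * ?S ?U"
      using f by (intro mult_left_mono) auto
    also have "?f * ?S ?U = ?S (X - Y)"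
      unfolding inner abs_mult sum_distrib_left using f by (intro sum.cong refl) simp
    finally show ?thesis by (simp add: mult_ac)
  qed
  have "(?\<kappa> - \<delta>) * ?f = 1 / real m * (m * ((?\<kappa> - \<delta>) * ?f))" using \<open>0 < m\<close> by simp
  also have "\<dots> \<le> 1 / real m * (l1_norm m (measure_op N d A (X - Y) - s) - l1_norm m s)"
    using main l1_norm_diff_ge[where s = s and m = m and v = "measure_op N d A (X - Y)"]
    by (intro mult_left_mono) (auto simp: measure_op_def)
  finally show ?thesis by (simp only: right_diff_distrib)
qed

lemma sets_sharpness:
  "{A \<in> space (gaussian_measurements N d m). \<forall>X. P X \<longrightarrow>
      1 / real m * l1_norm m (measure_op N d A (X - Y) - s) - 1 / real m * l1_norm m s
        \<ge> a * frob_norm N d (X - Y)} \<in> sets (gaussian_measurements N d m)"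
proof -
  let ?g = "\<lambda>A X. 1 / real m * (\<Sum>k=1..m. \<bar>tensor_inner N d (A k) (X - Y) - s k\<bar>) - 1 / real m * l1_norm m s
      - a * frob_norm N d (X - Y)"
  have "{A \<in> space (gaussian_measurements N d m). \<forall>X. P X \<longrightarrow> 0 \<le> ?g A X} \<in> sets (gaussian_measurements N d m)"
  proof (rule sets_Collect_all_continuous)
    show "(\<lambda>A. ?g A X) \<in> borel_measurable (gaussian_measurements N d m)" for X
      by (intro borel_measurable_diff borel_measurable_times borel_measurable_const borel_measurable_sum
          borel_measurable_abs borel_measurable_measurement)
    show "(\<lambda>n. ?g A (Z n)) \<longlonglongrightarrow> ?g A X"
      if "\<And>j. j \<in> multi_indices N d \<Longrightarrow> (\<lambda>n. Z n j) \<longlonglongrightarrow> X j" for A X Z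
    proof -
      have "(\<lambda>n. (Z n - Y) j) \<longlonglongrightarrow> (X - Y) j" if "j \<in> multi_indices N d" for j
        using \<open>\<And>j. j \<in> multi_indices N d \<Longrightarrow> (\<lambda>n. Z n j) \<longlonglongrightarrow> X j\<close>[OF that] by (simp add: tendsto_diff)
      then show ?thesis
        by (intro tendsto_diff tendsto_mult tendsto_const tendsto_sum tendsto_rabs
            tendsto_tensor_inner tendsto_frob_norm)
    qed
  qed
  then show ?thesis by (simp add: l1_norm_def measure_op_def)
qed

text \<open>
  The number of pairs of net points at level \<open>k\<close> is at most the exponential of
  \<open>88 * (k + 1) * (n * ln N)\<close>. The constant 200000 makes the exponent of the increment tail exceed it
  by \<open>2 * (k + 1) * (n * ln N)\<close>.
\<close>

lemma union_bound_level:
  fixes \<delta> M :: real and n l k N :: nat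
  assumes "2 \<le> N" "1 \<le> n" and l: "l * ln 2 \<le> 2 * ln (real N)"
    and M: "200000 * (n * ln N) \<le> M * \<delta>\<^sup>2"
    and c: "c \<le> 4 ^ ((k + l + 3) * (4 * n))" "c' \<le> 4 ^ ((Suc k + l + 3) * (4 * n))" "0 \<le> c" "0 \<le> (c'::real)"
  shows "c * c' * exp (- (M * (\<delta> * Suc k / 8)\<^sup>2 / 32)) \<le> exp (- (n * ln N)) * (1/2) ^ Suc k"
proof -
  define L where "L = n * ln (real N)"
  have lnN: "ln 2 \<le> ln (real N)" using \<open>2 \<le> N\<close> by simp
  have ln2: "0 < ln (2::real)" by simp
  have "1 * ln 2 \<le> real n * ln (real N)" using lnN ln2 \<open>1 \<le> n\<close> by (intro mult_mono) auto
  then have L1: "ln 2 \<le> L" by (simp add: L_def)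
  then have L: "ln 2 \<le> L" "0 \<le> L" using ln2 by linarith+
  have ln4: "ln (4::real) = 2 * ln 2" using ln_realpow[of 2 2] by simp
  have four: "(4::real) ^ i = exp (i * (2 * ln 2))" for i
    by (simp add: exp_of_nat_mult ln4[symmetric])
  \<comment> \<open>In the application \<open>4 * n\<close> counts the parameters at doubled ranks.
    With \<open>ln 4 = 2 * ln 2\<close> and \<open>l * ln 2 \<le> 2 * ln N\<close> the exponent
    becomes \<open>8 * (2 * k + 7 + 4) = 16 * k + 88\<close> times \<open>L\<close>.\<close>
  have "c * c' \<le> 4 ^ ((k + l + 3) * (4 * n)) * 4 ^ ((Suc k + l + 3) * (4 * n))"
    using c by (intro mult_mono) auto
  also have "\<dots> = 4 ^ ((2 * k + 2 * l + 7) * (4 * n))"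
    by (simp add: power_add[symmetric] algebra_simps)
  also have "\<dots> = exp ((8 * real n) * ((2 * real k + 7) * ln 2 + 2 * (l * ln 2)))"
    unfolding four by (simp add: algebra_simps)
  also have "\<dots> \<le> exp ((8 * real n) * ((2 * real k + 7) * ln N + 2 * (2 * ln N)))"
    using lnN l by (intro iffD2[OF exp_le_cancel_iff] mult_left_mono add_mono) auto
  also have "(8 * real n) * ((2 * real k + 7) * ln N + 2 * (2 * ln N)) = L * (16 * real k + 88)"
    by (simp add: L_def algebra_simps)
  also have "exp (L * (16 * real k + 88)) \<le> exp (L * (88 * Suc k))"
    using L by (intro iffD2[OF exp_le_cancel_iff] mult_left_mono) auto
  finally have cc: "c * c' \<le> exp (L * (88 * Suc k))" .
  \<comment> \<open>The denominator 2048 is \<open>8\<^sup>2 * 32\<close>, and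
    \<open>200000 / 2048\<close> exceeds 90. The rest is \<open>K \<le> K\<^sup>2\<close>.\<close>
  have "90 * L * K \<le> M * (\<delta> * K / 8)\<^sup>2 / 32" if "1 \<le> K" for K :: real
  proof -
    have A: "200000 * L \<le> M * \<delta>\<^sup>2" using M by (simp add: L_def)
    then have "0 \<le> M * \<delta>\<^sup>2" using L by linarith
    then have "200000 * L * (K * 1) \<le> M * \<delta>\<^sup>2 * (K * K)"
      using that by (intro mult_mono[OF A] mult_left_mono) auto
    moreover have "0 \<le> L * K" using L that by simp
    moreover have "M * (\<delta> * K / 8)\<^sup>2 / 32 = M * \<delta>\<^sup>2 * (K * K) / 2048"
      by (simp add: power2_eq_square)
    ultimately show ?thesis by linarith
  qed
  from this[of "Suc k"] have "c * c' * exp (- (M * (\<delta> * Suc k / 8)\<^sup>2 / 32)) \<le> exp (L * (88 * Suc k)) * exp (- (90 * L * Suc k))"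
    using cc c by (intro mult_mono) auto
  also have "\<dots> = exp (- (2 * L * Suc k))" by (simp add: exp_add[symmetric] algebra_simps)
  \<comment> \<open>One share \<open>L\<close> is kept as the overall factor, and the other
    \<open>L * Suc k\<close> supplies the geometric weight because
    \<open>ln 2 \<le> L\<close>.\<close>
  also have "\<dots> \<le> exp (- L + - L * Suc k)"
    using L by (simp add: algebra_simps)
  also have "\<dots> = exp (- L) * exp (- L) ^ Suc k"
    by (simp only: exp_add exp_of_nat_mult[symmetric] mult.commute)
  also have "\<dots> \<le> exp (- L) * (1/2) ^ Suc k"
  proof -
    have "exp (- L) \<le> exp (- ln 2)" using L by simp
    also have "\<dots> = 1/2" by (simp add: exp_minus inverse_eq_divide)
    finally show ?thesis by (intro mult_left_mono power_mono) auto
  qed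
  finally show ?thesis by (simp add: L_def)
qed

text \<open>Rounding the binary logarithm up to an integer adds at most 1, which is at most the
  logarithm itself for \<open>2 \<le> N\<close>; hence the factor 2.\<close>

lemma ex_dyadic_exponent:
  assumes "2 \<le> N"
  obtains l where "N \<le> 2 ^ l" "l * ln 2 \<le> 2 * ln (real N)"
proof -
  obtain n where n: "2 ^ n \<le> N" "N < 2 ^ (n + 1)"
    using ex_power_ivl1[of 2 N] assms by auto
  have "real (2 ^ n) \<le> real N" using n(1) by (rule of_nat_mono)
  then have "ln (2 ^ n) \<le> ln (real N)" using assms by (intro ln_mono) auto
  then have "n * ln 2 \<le> ln (real N)" by (simp add: ln_realpow)
  moreover have "ln 2 \<le> ln (real N)" using assms by simp
  ultimately have "(n + 1) * ln 2 \<le> 2 * ln (real N)" by (simp add: algebra_simps)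
  with n(2) show ?thesis by (intro that[of "n + 1"]) auto
qed

lemma sharpness_probability:
  fixes D \<rho> :: nat
  assumes N: "2 \<le> N" and d: "\<And>i. i \<in> {1..N} \<Longrightarrow> d i \<le> D" and r: "tt_ranks N r" "\<And>i. i \<le> N \<Longrightarrow> r i \<le> \<rho>"
    and "1 \<le> D" and Y: "tt_format N d r Y" and "0 < \<delta>"
    and m: "200000 * (N * D * \<rho>\<^sup>2 * ln N) \<le> m * \<delta>\<^sup>2"
  shows "\<P>(A in gaussian_measurements N d m. \<forall>X. tt_format N d r X \<longrightarrow>
      1 / real m * l1_norm m (measure_op N d A (X - Y) - s) - 1 / real m * l1_norm m s
        \<ge> ((1 - 2 * outlier_fraction m s) * sqrt (2 / pi) - \<delta>) * frob_norm N d (X - Y))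
    \<ge> 1 - exp (- (N * D * \<rho>\<^sup>2 * ln N))"
proof -
  let ?G = "gaussian_measurements N d m" and ?n = "N * D * \<rho>\<^sup>2"
  interpret prob_space ?G by (rule prob_space_gaussian_measurements)
  have "1 \<le> \<rho>" using r(2)[of 0] r(1) by (simp add: tt_ranks_def)
  then have n: "1 \<le> ?n" using N \<open>1 \<le> D\<close> by (simp add: Suc_le_eq)
  then have "0 < real ?n" by linarith
  \<comment> \<open>\<open>2 \<le> N\<close> makes the logarithm positive, so the sample size
    condition forces \<open>m\<close> to be positive.\<close>
  then have "0 < 200000 * (real ?n * ln N)" using N by (intro mult_pos_pos) auto
  then have "0 < m * \<delta>\<^sup>2" by (rule less_le_trans) (use m in simp)
  then have "0 < m" by (cases m) auto
  obtain l where l: "N \<le> 2 ^ l" "l * ln 2 \<le> 2 * ln (real N)"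
    using ex_dyadic_exponent[OF N] by blast
  have "\<forall>k. \<exists>T. finite T \<and> card T \<le> 4 ^ ((k + l + 3) * (N * D * (2 * \<rho>)\<^sup>2)) \<and>
    (\<forall>Q. factors_le N d (2 * \<rho>) 1 Q \<longrightarrow> (\<exists>t\<in>T. frob_norm N d ((\<lambda>j. tt_row (2 * \<rho>) Q j N 0) - t) \<le> (1/2) ^ k))"
  proof
    fix k
    show "\<exists>T. finite T \<and> card T \<le> 4 ^ ((k + l + 3) * (N * D * (2 * \<rho>)\<^sup>2)) \<and>
      (\<forall>Q. factors_le N d (2 * \<rho>) 1 Q \<longrightarrow> (\<exists>t\<in>T. frob_norm N d ((\<lambda>j. tt_row (2 * \<rho>) Q j N 0) - t) \<le> (1/2) ^ k))"
      by (rule ex_tt_net[of N d D "2 * \<rho>" l k]) (use d l \<open>1 \<le> \<rho>\<close> in auto)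
  qed
  then obtain T' where T': "\<And>k. finite (T' k)" "\<And>k. card (T' k) \<le> 4 ^ ((k + l + 3) * (N * D * (2 * \<rho>)\<^sup>2))"
    "\<And>k Q. factors_le N d (2 * \<rho>) 1 Q \<Longrightarrow> \<exists>t\<in>T' k. frob_norm N d ((\<lambda>j. tt_row (2 * \<rho>) Q j N 0) - t) \<le> (1/2) ^ k"
    by metis
  \<comment> \<open>The chain has to start where the process vanishes, so level 0 becomes the zero
    tensor. A singleton respects the cardinality bound.\<close>
  define T where "T k = (if k = 0 then {\<lambda>_. 0} else T' k)" for k
  have finT: "finite (T k)" for k using T'(1) by (simp add: T_def)
  have "card (T k) \<le> 4 ^ ((k + l + 3) * (4 * ?n))" for k
    using T'(2)[of k] by (simp add: T_def power_mult_distrib mult_ac)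
  then have cardT: "real (card (T k)) \<le> 4 ^ ((k + l + 3) * (4 * ?n))" for k
    using of_nat_mono[where 'a = real, of "card (T k)" "4 ^ ((k + l + 3) * (4 * ?n))"] by simp
  have net: "\<exists>t\<in>T k. frob_norm N d ((\<lambda>j. tt_row (2 * \<rho>) Q j N 0) - t) \<le> (1/2) ^ k"
    if "factors_le N d (2 * \<rho>) 1 Q" for Q k
    using T'(3)[OF that, of k] frob_norm_tt_row_le[OF that] \<open>1 \<le> \<rho>\<close> by (simp add: T_def fun_diff_def)
  have small: "card (T k) * card (T (Suc k)) * exp (- (m * (\<delta> * Suc k / 8)\<^sup>2 / 32)) \<le> exp (- (?n * ln N)) * (1/2) ^ Suc k" for k
    using union_bound_level[OF N n l(2) _ cardT[of k] cardT[of "Suc k"], of "real m" \<delta>] m by simp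
  have sign: "\<bar>outlier_sign s k\<bar> \<le> 1" for k by (simp add: outlier_sign_def)
  obtain B where B: "B \<in> sets ?G" "measure ?G B \<le> exp (- (?n * ln N))"
    "\<forall>A\<in>space ?G - B. \<forall>k. \<forall>t\<in>T k. \<forall>t'\<in>T (Suc k).
      centered_sum N d m (outlier_sign s) A t - centered_sum N d m (outlier_sign s) A t'
        \<le> m * (\<delta> * Suc k / 8) * frob_norm N d (t - t')"
    by (rule chaining_tail[where N = N and d = d, OF sign \<open>0 < \<delta>\<close> finT small]) (rule that)
  let ?E = "{A \<in> space ?G. \<forall>X. tt_format N d r X \<longrightarrow>
      1 / real m * l1_norm m (measure_op N d A (X - Y) - s) - 1 / real m * l1_norm m s
        \<ge> ((1 - 2 * outlier_fraction m s) * sqrt (2 / pi) - \<delta>) * frob_norm N d (X - Y)}"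
  have "space ?G - B \<subseteq> ?E"
  proof
    fix A assume A: "A \<in> space ?G - B"
    have "- (m * \<delta>) \<le> centered_sum N d m (outlier_sign s) A (\<lambda>j. tt_row (2 * \<rho>) Q j N 0)"
      if "factors_le N d (2 * \<rho>) 1 Q" for Q
    proof (rule chaining_lower_bound)
      show "T 0 = {\<lambda>_. 0}" by (simp add: T_def)
    qed (use net[OF that] B(3) A \<open>0 < \<delta>\<close> in \<open>blast, blast, simp\<close>)
    from sharpness_if_centered_sum_ge[OF \<open>0 < m\<close> N r _ Y this]
    show "A \<in> ?E" using A by simp
  qed
  then have "measure ?G (space ?G - B) \<le> measure ?G ?E"
    by (intro finite_measure_mono sets_sharpness)
  then show ?thesis using prob_compl[OF B(1)] B(2) by simp
qed

theorem lemma1: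
  "\<exists>C > 0. \<exists>c > 0. \<forall>(N::nat) (d::nat \<Rightarrow> nat) (r::nat \<Rightarrow> nat) (Xstar::tensor)
      (m::nat) (s::nat \<Rightarrow> real) (\<delta>::real).
    1 \<le> N \<longrightarrow> (\<forall>i\<in>{1..N}. 1 \<le> d i) \<longrightarrow> tt_ranks N r \<longrightarrow>
    tt_format N d r Xstar \<longrightarrow>
    0 < \<delta> \<longrightarrow> \<delta> < (1 - 2 * outlier_fraction m s) * sqrt (2 / pi) \<longrightarrow>
    real m \<ge> C * (real N * real (max_dim N d) * real (max_rank N r) ^ 2 * ln (real N)) / \<delta> ^ 2 \<longrightarrow>
    \<P>(A in gaussian_measurements N d m. 
        \<forall>X. tt_format N d r X \<longrightarrow>
          1 / real m * l1_norm m (measure_op N d A (X - Xstar) - s) - 1 / real m * l1_norm m s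
            \<ge> ((1 - 2 * outlier_fraction m s) * sqrt (2 / pi) - \<delta>) * frob_norm N d (X - Xstar))
      > 1 - 2 * exp (- c * real N * real (max_dim N d) * real (max_rank N r) ^ 2 * ln (real N))"
\<comment> \<open>\<open>C\<close> is the constant of the union bound over the levels, and
  \<open>c\<close> is 1 because the total failure probability keeps one share of the
  exponent.\<close>
proof (rule exI[of _ 200000], rule conjI[OF _ exI[of _ 1]], simp, rule conjI, simp, intro allI impI)
  fix N :: nat and d r :: "nat \<Rightarrow> nat" and Y :: tensor and m :: nat and s :: "nat \<Rightarrow> real" and \<delta> :: real
  assume "1 \<le> N" and d: "\<forall>i\<in>{1..N}. 1 \<le> d i" and r: "tt_ranks N r" and Y: "tt_format N d r Y" and "0 < \<delta>"
    and m: "200000 * (real N * real (max_dim N d) * real (max_rank N r) ^ 2 * ln (real N)) / \<delta> ^ 2 \<le> real m"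
  let ?P = "\<P>(A in gaussian_measurements N d m. \<forall>X. tt_format N d r X \<longrightarrow>
          1 / real m * l1_norm m (measure_op N d A (X - Y) - s) - 1 / real m * l1_norm m s
            \<ge> ((1 - 2 * outlier_fraction m s) * sqrt (2 / pi) - \<delta>) * frob_norm N d (X - Y))"
  show "1 - 2 * exp (- 1 * real N * real (max_dim N d) * real (max_rank N r) ^ 2 * ln (real N)) < ?P"
  proof (cases "N = 1")
    \<comment> \<open>Since \<open>ln 1 = 0\<close>, the claimed lower bound is -1, which any
      probability exceeds.\<close>
    case True
    have "- 1 < ?P" by (rule less_le_trans[OF _ measure_nonneg]) simp
    then show ?thesis using True by simp
  next
    case False
    then have N: "2 \<le> N" using \<open>1 \<le> N\<close> by simp
    have D: "d i \<le> max_dim N d" if "i \<in> {1..N}" for i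
      unfolding max_dim_def using that by (intro Max_ge) auto
    have \<rho>: "r i \<le> max_rank N r" if "i \<le> N" for i
      unfolding max_rank_def using that by (intro Max_ge) auto
    have "1 \<in> {1..N}" using \<open>1 \<le> N\<close> by simp
    with D d have "1 \<le> max_dim N d" by (meson order_trans)
    moreover have "200000 * (N * max_dim N d * (max_rank N r)\<^sup>2 * ln N) \<le> m * \<delta>\<^sup>2"
      using m \<open>0 < \<delta>\<close> by (simp add: pos_divide_le_eq)
    ultimately have "1 - exp (- (N * max_dim N d * (max_rank N r)\<^sup>2 * ln N)) \<le> ?P"
      using sharpness_probability[OF N D r \<rho> _ Y \<open>0 < \<delta>\<close>] by blast
    moreover have "exp (- 1 * real N * real (max_dim N d) * real (max_rank N r) ^ 2 * ln (real N)) =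
        exp (- (N * max_dim N d * (max_rank N r)\<^sup>2 * ln N))" by simp
    \<comment> \<open>Positivity and the factor 2 in the claim turn the weak inequality into a
      strict one.\<close>
    moreover have "0 < exp (- (N * max_dim N d * (max_rank N r)\<^sup>2 * ln N))" by simp
    ultimately show ?thesis by linarith
  qed
qed

end
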